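(* Let $\gamma$ be a continuous (atomless) Borel probability measure of full support on the half-line $[0,\infty)$, and let $\nu_\gamma$ be the associated probability measure on the cone of distance matrices $\mathcal{R}$ (see context). Then $\nu_\gamma$ is concentrated on the set of universal matrices; in other words, $\nu_\gamma$-almost every distance matrix is universal. Therefore, for $\nu_\gamma$-almost every matrix $r$, the completion of the set of positive integers $\mathbf{N}$ with respect to the metric determined by $r$ is isometric to the Urysohn universal space.
   Context: $\mathcal{R}$ is the set of all real matrices $r=\{r_{i,j}\}_{i,j=1}^\infty$ with $r_{i,i}=0$, $r_{i,j}\ge 0$, $r_{i,j}=r_{j,i}$ and $r_{i,k}+r_{k,j}\ge r_{i,j}$ for all $i,j,k$, with the topology of entrywise convergence. Definition of $\nu_\gamma$: it is the distribution of the random matrix $r\in\mathcal{R}$ whose entries above the diagonal are chosen successively, column by column ($n=2,3,\dots$) and within column $n$ from top to bottom, as follows. The entries $r_{1,n}$, $n=2,3,\dots$, are i.i.d. with distribution $\gamma$, $r_{1,n}$ being independent of all $r_{i,j}$ with $i,j\le n-1$. For $n>2$ and $1\le k<n-1$, given all $r_{i,j}$ with $i,j\le n-1$ and $r_{i,n}$ with $i\le k$, the conditional distribution of $r_{k+1,n}$ is the normalized Lebesgue measure (uniform distribution) on the interval $\big[\max_{1\le i\le k}|r_{i,k+1}-r_{i,n}|,\ \min_{1\le i\le k}(r_{i,k+1}+r_{i,n})\big]$ (which is always nonempty). For $r\in\mathcal{R}$, $p_n(r)=\{r_{i,j}\}_{i,j=1}^n$; for a distance matrix $q$ of order $n$,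 $A(q)=\{(a_1,\dots,a_n)\in\mathbf{R}^n: |a_i-a_j|\le q_{i,j}\le a_i+a_j,\ i,j=1,\dots,n\}$. A matrix $r\in\mathcal{R}$ is called universal if for every $\epsilon>0$, every $n\in\mathbf{N}$ and every $a\in A(p_n(r))$ there exists $m\in\mathbf{N}$ with $\max_{i\le n}|r_{i,m}-a_i|<\epsilon$. The Urysohn space is the complete separable metric space, unique up to isometry, that contains an isometric copy of every complete separable metric space and in which every isometry between two finite subsets extends to an isometry of the whole space onto itself. *)

theory Defs
  imports "HOL-Probability.Probability" "HOL-Library.Nat_Bijection"
begin

section \<open>Distance matrices and universality\<close>

text \<open>
  Matrices are functions \<open>nat \<Rightarrow> nat \<Rightarrow> real\<close>; rows and columns are numbered from \<open>0\<close>,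
  so index \<open>i\<close> stands for the positive integer \<open>i + 1\<close>. The topology of entrywise convergence is
  the topology of the function type, and \<open>borel\<close> is its Borel \<open>\<sigma>\<close>-algebra.
\<close>

definition distance_matrices :: "(nat \<Rightarrow> nat \<Rightarrow> real) set" where
  "distance_matrices = {r. \<forall>i j k. r i i = 0 \<and> r i j \<ge> 0 \<and> r i j = r j i \<and> r i k + r k j \<ge> r i j}"

text \<open>Only the components \<open>a i\<close> with \<open>i < n\<close> and the \<open>n \<times> n\<close> corner of \<open>q\<close> are constrained.\<close>

definition admissible_vectors :: "nat \<Rightarrow> (nat \<Rightarrow> nat \<Rightarrow> real) \<Rightarrow> (nat \<Rightarrow> real) set" where
  "admissible_vectors n q = {a. \<forall>i<n. \<forall>j<n. \<bar>a i - a j\<bar> \<le> q i j \<and> q i j \<le> a i + a j}"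

definition universal_matrix :: "(nat \<Rightarrow> nat \<Rightarrow> real) \<Rightarrow> bool" where
  "universal_matrix r \<longleftrightarrow> r \<in> distance_matrices \<and>
     (\<forall>\<epsilon>>0. \<forall>n. \<forall>a\<in>admissible_vectors n r. \<exists>m. \<forall>i<n. \<bar>r i m - a i\<bar> < \<epsilon>)"


section \<open>The random distance matrix\<close>

text \<open>
  The entries above the diagonal form a sequence \<open>x\<close>: entry \<open>(i, j)\<close> with \<open>i < j\<close> is
  \<open>x (prod_encode (i, j - i - 1))\<close>. As \<open>prod_encode (m, n) = triangle (m + n) + m\<close>, this runs
  through the columns \<open>1, 2, \<dots>\<close> in turn, and through each column from top to bottom.
\<close>

definition matrix_of_seq :: "(nat \<Rightarrow> real) \<Rightarrow> nat \<Rightarrow> nat \<Rightarrow> real" where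
  "matrix_of_seq x i j =
     (if i < j then x (prod_encode (i, j - i - 1))
      else if j < i then x (prod_encode (j, i - j - 1))
      else 0)"

text \<open>On a degenerate interval the normalized Lebesgue measure is read as the point mass. The case
  \<open>a > b\<close> does not arise for distance matrices.\<close>

definition uniform_interval :: "real \<Rightarrow> real \<Rightarrow> real measure" where
  "uniform_interval a b = (if a < b then uniform_measure lborel {a..b} else return borel a)"

text \<open>The conditional distribution of entry number \<open>t\<close>, which is in row \<open>k\<close> and column
  \<open>n = k + d + 1\<close>, given the earlier entries \<open>x 0, \<dots>, x (t - 1)\<close>.\<close>

definition entry_kernel :: "real measure \<Rightarrow> nat \<Rightarrow> (nat \<Rightarrow> real) \<Rightarrow> real measure" where
  "entry_kernel \<gamma> t x =
     (case prod_decode t of (k, d) \<Rightarrow>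
        let n = k + d + 1; r = matrix_of_seq x in
        if k = 0 then \<gamma>
        else uniform_interval (MAX i\<in>{..<k}. \<bar>r i k - r i n\<bar>) (MIN i\<in>{..<k}. r i k + r i n))"

definition random_matrix_measure :: "real measure \<Rightarrow> (nat \<Rightarrow> nat \<Rightarrow> real) measure" where
  "random_matrix_measure \<gamma> =
     distr (projective_family.lim UNIV (Ionescu_Tulcea.CI (entry_kernel \<gamma>) (\<lambda>_. borel)) (\<lambda>_. borel))
       borel matrix_of_seq"

definition measure_support :: "'a::topological_space measure \<Rightarrow> 'a set" where
  "measure_support M = {x. \<forall>U. open U \<and> x \<in> U \<longrightarrow> emeasure M U > 0}"

lemma measurable_uniform_interval:
  assumes [measurable]: "f \<in> borel_measurable M" "g \<in> borel_measurable M"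
  shows "(\<lambda>x. uniform_interval (f x) (g x)) \<in> measurable M (subprob_algebra borel)"
proof (rule measurable_subprob_algebra)
  fix x
  have "prob_space (uniform_interval (f x) (g x))"
    unfolding uniform_interval_def
    by (auto intro!: prob_space_uniform_measure prob_space_return)
  then show "subprob_space (uniform_interval (f x) (g x))"
    by (rule prob_space_imp_subprob_space)
  show "sets (uniform_interval (f x) (g x)) = sets borel"
    by (simp add: uniform_interval_def)
next
  fix A :: "real set" assume A[measurable]: "A \<in> sets borel"
  have "emeasure (uniform_interval (f x) (g x)) A =
      (if f x < g x then (\<integral>\<^sup>+y. (if f x \<le> y \<and> y \<le> g x \<and> y \<in> A then 1 else 0) \<partial>lborel) / ennreal (g x - f x)
       else indicator A (f x))" for x
  proof -
    have "emeasure lborel ({f x..g x} \<inter> A) =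
        (\<integral>\<^sup>+y. (if f x \<le> y \<and> y \<le> g x \<and> y \<in> A then 1 else 0) \<partial>lborel)"
      by (subst nn_integral_indicator[symmetric])
         (simp, rule nn_integral_cong, simp add: indicator_def)
    then show ?thesis
      by (simp add: uniform_interval_def)
  qed
  then show "(\<lambda>x. emeasure (uniform_interval (f x) (g x)) A) \<in> borel_measurable M"
    by simp
qed

lemma Ionescu_Tulcea_entry_kernel:
  assumes "prob_space \<gamma>" "sets \<gamma> = sets borel"
  shows "Ionescu_Tulcea (entry_kernel \<gamma>) (\<lambda>_. borel)"
proof (rule Ionescu_Tulcea.intro)
  fix t
  obtain k d where t: "t = prod_encode (k, d)"
    by (metis prod_decode_inverse surj_pair)
  have *: "(\<lambda>x. matrix_of_seq x i j) \<in> borel_measurable (PiM {0..<t} (\<lambda>_. borel))"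
    if "i < k" "j = k \<or> j = k + d + 1" for i j
  proof -
    have "i < j" using that by auto
    have "prod_encode (i, j - i - 1) < t"
    proof -
      have *: "triangle a + b < triangle c" if "a < c" "b \<le> a" for a b c
      proof -
        have "mono triangle"
          by (intro mono_iff_le_Suc[THEN iffD2]) simp
        then have "triangle (Suc a) \<le> triangle c"
          using that(1) by (rule monoD[OF _ Suc_leI])
        with that(2) show ?thesis by simp
      qed
      from that(2) show ?thesis
      proof
        assume 1: "j = k"
        then have "triangle (i + (j - i - 1)) + i < triangle (k + d)"
          using that by (intro *) auto
        then show ?thesis by (simp add: t prod_encode_def)
      next
        assume 2: "j = k + d + 1"
        with that have "i + (j - i - 1) = k + d" by simp
        with that show ?thesis by (simp add: t prod_encode_def)
      qed
    qed
    then show ?thesis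
      using \<open>i < j\<close> by (simp add: matrix_of_seq_def measurable_component_singleton)
  qed
  show "entry_kernel \<gamma> t \<in> measurable (PiM {0..<t} (\<lambda>_. borel)) (subprob_algebra borel)"
  proof (cases "k = 0")
    case True
    have "\<gamma> \<in> space (subprob_algebra borel)"
      using assms by (simp add: space_subprob_algebra prob_space_imp_subprob_space)
    with True show ?thesis
      by (simp add: entry_kernel_def[abs_def] t)
  next
    case False
    then show ?thesis
      unfolding entry_kernel_def[abs_def] t Let_def
      by (simp only: prod_encode_inverse prod.case if_False)
         (intro measurable_uniform_interval borel_measurable_Max borel_measurable_Min
           borel_measurable_abs borel_measurable_diff borel_measurable_add *[unfolded t]; simp)
  qed
next
  show "prob_space (entry_kernel \<gamma> t x)" for t x
    using assms
    by (auto simp: entry_kernel_def uniform_interval_def Let_def split: prod.split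
        intro!: prob_space_uniform_measure prob_space_return)
qed

lemma prob_space_random_matrix_measure:
  assumes "prob_space \<gamma>" "sets \<gamma> = sets borel"
  shows "prob_space (random_matrix_measure \<gamma>)"
proof -
  interpret IT: Ionescu_Tulcea "entry_kernel \<gamma>" "\<lambda>_. borel"
    using assms by (rule Ionescu_Tulcea_entry_kernel)
  have "distr IT.PF.lim (PiM {} (\<lambda>_. borel)) (\<lambda>x. restrict x {}) = IT.CI {}"
    by (rule IT.distr_lim) simp
  then have "prob_space (distr IT.PF.lim (PiM {} (\<lambda>_. borel)) (\<lambda>x. restrict x {}))"
    by (simp add: IT.PF.prob_space_P)
  then have "prob_space IT.PF.lim"
    by (rule prob_space_distrD[rotated])
       (auto simp: measurable_cong_sets[OF IT.PF.sets_lim refl] intro!: measurable_restrict)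
  moreover have "matrix_of_seq \<in> borel_measurable IT.PF.lim"
    unfolding measurable_cong_sets[OF IT.PF.sets_lim refl]
    by (intro measurable_coordinatewise_then_product) (simp add: matrix_of_seq_def)
  ultimately show ?thesis
    unfolding random_matrix_measure_def by (rule prob_space.prob_space_distr)
qed


section \<open>Metric spaces\<close>

definition isometric_embedding :: "'a metric \<Rightarrow> 'b metric \<Rightarrow> ('a \<Rightarrow> 'b) \<Rightarrow> bool" where
  "isometric_embedding X Y f \<longleftrightarrow> f \<in> mspace X \<rightarrow> mspace Y \<and>
     (\<forall>x\<in>mspace X. \<forall>y\<in>mspace X. mdist Y (f x) (f y) = mdist X x y)"

definition isometry :: "'a metric \<Rightarrow> 'b metric \<Rightarrow> ('a \<Rightarrow> 'b) \<Rightarrow> bool" where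
  "isometry X Y f \<longleftrightarrow> isometric_embedding X Y f \<and> f ` mspace X = mspace Y"

definition isometric_spaces :: "'a metric \<Rightarrow> 'b metric \<Rightarrow> bool" where
  "isometric_spaces X Y \<longleftrightarrow> (\<exists>f. isometry X Y f)"

definition is_completion :: "'a metric \<Rightarrow> 'b metric \<Rightarrow> bool" where
  "is_completion X Y \<longleftrightarrow> mcomplete_of Y \<and>
     (\<exists>f. isometric_embedding X Y f \<and> mtopology_of Y closure_of (f ` mspace X) = mspace Y)"

text \<open>Completions are unique up to isometry; the type \<open>'a \<Rightarrow> real\<close> is large enough to carry one.\<close>

definition mcompletion :: "'a metric \<Rightarrow> ('a \<Rightarrow> real) metric" where
  "mcompletion X = (SOME Y. is_completion X Y)"

lemma is_completion_mcompletion: "is_completion X (mcompletion X)"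
proof -
  interpret Metric_space "mspace X" "mdist X" by simp
  obtain f :: "['a, 'a] \<Rightarrow> real" and Y where "mcomplete_of Y" "f \<in> mspace X \<rightarrow> mspace Y"
    "mtopology_of Y closure_of f ` mspace X = mspace Y"
    "\<And>x y. \<lbrakk>x \<in> mspace X; y \<in> mspace X\<rbrakk> \<Longrightarrow> mdist Y (f x) (f y) = mdist X x y"
    by (rule metric_completion) blast
  then have "is_completion X Y"
    unfolding is_completion_def isometric_embedding_def by (intro conjI exI[of _ f] ballI)
  then show ?thesis
    unfolding mcompletion_def by (rule someI)
qed

text \<open>
  A space with these four properties is unique up to isometry.
  The third conjunct can only quantify over the metric spaces on one type. The type
  \<open>nat \<Rightarrow> real\<close> carries a copy of every separable metric space, see
  \<open>urysohn_space_embeds\<close> below.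
\<close>

definition urysohn_space :: "'a metric \<Rightarrow> bool" where
  "urysohn_space U \<longleftrightarrow>
     mcomplete_of U \<and>
     separable_space (mtopology_of U) \<and>
     (\<forall>X :: (nat \<Rightarrow> real) metric. mcomplete_of X \<and> separable_space (mtopology_of X) \<longrightarrow>
        (\<exists>f. isometric_embedding X U f)) \<and>
     (\<forall>A B h. finite A \<and> A \<subseteq> mspace U \<and> finite B \<and> B \<subseteq> mspace U \<and>
        isometry (submetric U A) (submetric U B) h \<longrightarrow>
        (\<exists>g. isometry U U g \<and> (\<forall>x\<in>A. g x = h x)))"

lemma urysohn_space_embeds:
  fixes X :: "'b metric"
  assumes U: "urysohn_space U"
    and X: "mcomplete_of X" "separable_space (mtopology_of X)"
  shows "\<exists>f. isometric_embedding X U f"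
proof -
  interpret X: Metric_space "mspace X" "mdist X" by simp
  obtain C where C: "countable C" "C \<subseteq> mspace X" "X.mtopology closure_of C = mspace X"
    using X(2) by (auto simp: separable_space_def mtopology_of_def)
  define F where "F x n = mdist X x (from_nat_into C n)" for x n
  have inj: "inj_on F (mspace X)"
  proof (rule inj_onI, rule ccontr)
    fix x y assume xy: "x \<in> mspace X" "y \<in> mspace X" "F x = F y" "x \<noteq> y"
    define e where "e = mdist X x y / 2"
    have "e > 0" using xy by (simp add: e_def)
    with C(3) xy(1) obtain c where c: "c \<in> C" "mdist X x c < e"
      by (auto simp: X.metric_closure_of)
    obtain n where n: "from_nat_into C n = c"
      using from_nat_into_surj[OF C(1) c(1)] by auto
    have "mdist X x c = mdist X y c"
      using fun_cong[OF xy(3), of n] by (simp add: F_def n)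
    moreover have "mdist X x y \<le> mdist X x c + mdist X c y"
      using C(2) c(1) xy by (intro mdist_triangle) auto
    ultimately show False
      using c(2) by (simp add: e_def mdist_commute)
  qed
  define G where "G = inv_into (mspace X) F"
  have G: "G (F x) = x" if "x \<in> mspace X" for x
    using inj that by (simp add: G_def)
  define M where "M = F ` mspace X"
  define D where "D p q = mdist X (G p) (G q)" for p q
  interpret D: Metric_space M D
    by standard (auto simp: M_def D_def G mdist_commute intro: mdist_triangle)
  define Y where "Y = metric (M, D)"
  have Y: "mspace Y = M" "mdist Y = D" by (simp_all add: Y_def)
  interpret XY: Metric_space12 "mspace X" "mdist X" M D ..
  have homeo: "homeomorphic_map X.mtopology D.mtopology F"
    by (intro XY.isometry_imp_homeomorphic_map) (auto simp: M_def D_def G)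
  have "separable_space (mtopology_of Y)"
    using homeomorphic_separable_space[OF homeomorphic_map_imp_homeomorphic_space[OF homeo]] X(2)
    by (simp add: Y_def mtopology_of_def)
  moreover have "D.mcomplete"
    unfolding D.mcomplete_def
  proof (intro allI impI)
    fix \<sigma> assume \<sigma>: "D.MCauchy \<sigma>"
    then have "range \<sigma> \<subseteq> M" by (simp add: D.MCauchy_def)
    then have G\<sigma>: "G (\<sigma> n) \<in> mspace X" "F (G (\<sigma> n)) = \<sigma> n" for n
      by (auto simp: M_def G dest!: subsetD[of _ _ "\<sigma> n"])
    have "X.MCauchy (G \<circ> \<sigma>)"
      using \<sigma> G\<sigma> by (auto simp: X.MCauchy_def D.MCauchy_def D_def)
    then obtain l where "limitin X.mtopology (G \<circ> \<sigma>) l sequentially"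
      using X(1) by (auto simp: mcomplete_of_def X.mcomplete_def)
    then have "limitin D.mtopology (F \<circ> (G \<circ> \<sigma>)) (F l) sequentially"
      using homeo by (intro continuous_map_limit) (auto dest: homeomorphic_imp_continuous_map)
    then show "\<exists>l. limitin D.mtopology \<sigma> l sequentially"
      using G\<sigma> by (auto simp: comp_def)
  qed
  then have "mcomplete_of Y" by (simp add: Y_def)
  ultimately obtain f where f: "isometric_embedding Y U f"
    using U by (auto simp: urysohn_space_def)
  have "isometric_embedding X U (f \<circ> F)"
    using f by (auto simp: isometric_embedding_def Y M_def D_def G Pi_iff)
  then show ?thesis by blast
qed

end

theory Submission
  imports Defs
begin

text \<open>
  Almost sure universality: the law of the first \<open>n\<close> entries of a new column depends only on the
  \<open>n \<times> n\<close> corner of the matrix. If a vector \<open>a\<close> lies well inside the admissible set of that corner,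
  each of these entries in turn falls near its target with probability bounded below: the first one
  because \<open>\<gamma>\<close> has full support, the others because the uniform interval contains a fixed neighbourhood
  of the target and has bounded length. Hence almost surely some column comes near \<open>a\<close>. Countably
  many rational \<open>a\<close> suffice, because every admissible vector can be pushed inwards when
  the off-diagonal entries of the corner are positive.

  Universality passes to the completion as an approximate one-point extension property, which by
  completeness is exact: a nearby solution can be corrected by a small step to a better one. A back-and-forth argument then
  makes any two complete separable spaces with this property isometric, by an isometry extending a
  prescribed finite one, and makes each of them contain every separable metric space.
\<close>

section \<open>One-point extensions\<close>

text \<open>Katetov functions: the possible distances to the points of \<open>F\<close> from one
  further point, which may coincide with a point of \<open>F\<close>. The case \<open>x = y\<close>
  yields \<open>f x \<ge> 0\<close> at points of the space.\<close>

definition katetov_on :: "'a metric \<Rightarrow> 'a set \<Rightarrow> ('a \<Rightarrow> real) \<Rightarrow> bool" where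
  "katetov_on X F f \<longleftrightarrow>
     (\<forall>x\<in>F. \<forall>y\<in>F. \<bar>f x - f y\<bar> \<le> mdist X x y \<and> mdist X x y \<le> f x + f y)"

text \<open>The case \<open>F = {}\<close> is included, so the property makes the space
  nonempty.\<close>

definition extension_property :: "'a metric \<Rightarrow> bool" where
  "extension_property X \<longleftrightarrow>
     (\<forall>F f. finite F \<and> F \<subseteq> mspace X \<and> katetov_on X F f \<longrightarrow>
        (\<exists>z\<in>mspace X. \<forall>x\<in>F. mdist X z x = f x))"

definition approx_extension_property :: "'a metric \<Rightarrow> bool" where
  "approx_extension_property X \<longleftrightarrow>
     (\<forall>F f \<epsilon>. finite F \<and> F \<subseteq> mspace X \<and> katetov_on X F f \<and> \<epsilon> > 0 \<longrightarrow>
        (\<exists>z\<in>mspace X. \<forall>x\<in>F. \<bar>mdist X z x - f x\<bar> < \<epsilon>))"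

lemma katetov_onD:
  assumes "katetov_on X F f" "x \<in> F" "y \<in> F"
  shows "f x \<le> f y + mdist X x y" "mdist X x y \<le> f x + f y"
  using assms unfolding katetov_on_def by (fastforce simp: abs_le_iff)+

text \<open>The largest 1-Lipschitz extension \<open>y \<mapsto> Min (f x + mdist X x y)\<close>
  serves. As \<open>F\<close> is finite the minimum is attained, so every estimate reduces to
  triangle inequalities through actual points of \<open>F\<close>.\<close>

lemma katetov_extension:
  assumes F: "finite F" "F \<noteq> {}" "F \<subseteq> mspace X" and f: "katetov_on X F f"
  obtains g where "katetov_on X (mspace X) g" "\<And>x. x \<in> F \<Longrightarrow> g x = f x"
proof -
  define g where "g y = Min ((\<lambda>x. f x + mdist X x y) ` F)" for y
  have g_le: "g y \<le> f x + mdist X x y" if "x \<in> F" for x y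
    unfolding g_def using F that by (intro Min_le) auto
  have g_ex: "\<exists>x\<in>F. g y = f x + mdist X x y" for y
  proof -
    have "g y \<in> (\<lambda>x. f x + mdist X x y) ` F"
      unfolding g_def using F by (intro Min_in) auto
    then show ?thesis by auto
  qed
  have lip: "g y \<le> g z + mdist X y z" if yz: "y \<in> mspace X" "z \<in> mspace X" for y z
  proof -
    obtain x where x: "x \<in> F" "g z = f x + mdist X x z" using g_ex by blast
    have "mdist X x y \<le> mdist X x z + mdist X z y"
      using x F yz by (intro mdist_triangle) auto
    with g_le[OF x(1), of y] x(2) show ?thesis by (simp add: mdist_commute)
  qed
  have sum: "mdist X y z \<le> g y + g z" if yz: "y \<in> mspace X" "z \<in> mspace X" for y z
  proof -
    obtain x where x: "x \<in> F" "g z = f x + mdist X x z" using g_ex by blast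
    obtain x' where x': "x' \<in> F" "g y = f x' + mdist X x' y" using g_ex by blast
    have "mdist X y z \<le> mdist X y x + mdist X x z" "mdist X y x \<le> mdist X y x' + mdist X x' x"
      using x x' F yz by (auto intro!: mdist_triangle)
    with katetov_onD(2)[OF f x'(1) x(1)] x x' show ?thesis by (simp add: mdist_commute)
  qed
  have "katetov_on X (mspace X) g"
    unfolding katetov_on_def using lip sum by (fastforce simp: abs_le_iff mdist_commute)
  moreover have "g x = f x" if "x \<in> F" for x
  proof (rule antisym)
    have "mdist X x x = 0" using F(3) that by auto
    with g_le[OF that, of x] show "g x \<le> f x" by simp
    obtain y where y: "y \<in> F" "g x = f y + mdist X y x" using g_ex by blast
    then show "f x \<le> g x" using katetov_onD(1)[OF f that y(1)] by (simp add: mdist_commute)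
  qed
  ultimately show ?thesis by (rule that)
qed

text \<open>The Katetov function through a nearby point \<open>z\<close>: its value at \<open>z\<close> is the error of \<open>z\<close>.\<close>

lemma katetov_on_insert_error:
  assumes F: "finite F" "F \<noteq> {}" "F \<subseteq> mspace X" "z \<in> mspace X" "z \<notin> F" and f: "katetov_on X F f"
  shows "katetov_on X (insert z F) (f(z := MAX x\<in>F. \<bar>mdist X z x - f x\<bar>))"
proof -
  define e where "e = (MAX x\<in>F. \<bar>mdist X z x - f x\<bar>)"
  have ge: "\<bar>mdist X z x - f x\<bar> \<le> e" if "x \<in> F" for x
    unfolding e_def using F that by (intro Max_ge) auto
  have "e \<in> (\<lambda>x. \<bar>mdist X z x - f x\<bar>) ` F"
    unfolding e_def using F by (intro Max_in) auto
  then obtain y where y: "y \<in> F" "e = \<bar>mdist X z y - f y\<bar>" by blast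
  \<comment> \<open>The error is attained at \<open>y\<close>. Both signs of
    \<open>mdist X z y - f y\<close> are bounded by passing from \<open>y\<close> to
    \<open>x\<close> and using the Katetov inequalities for that pair.\<close>
  have le: "e \<le> mdist X z x + f x" if x: "x \<in> F" for x
  proof -
    have "mdist X z y \<le> mdist X z x + mdist X x y" "mdist X y x \<le> mdist X y z + mdist X z x"
      using F x y by (auto intro!: mdist_triangle)
    with katetov_onD[OF f x y(1)] katetov_onD[OF f y(1) x] y(2) show ?thesis
      by (simp add: mdist_commute abs_if)
  qed
  show ?thesis
    unfolding katetov_on_def
  proof (intro ballI)
    fix u v assume uv: "u \<in> insert z F" "v \<in> insert z F"
    have "e \<ge> 0" "mdist X z z = 0" using y F(4) by auto
    with uv show "\<bar>(f(z := MAX x\<in>F. \<bar>mdist X z x - f x\<bar>)) u - (f(z := MAX x\<in>F. \<bar>mdist X z x - f x\<bar>)) v\<bar> \<le> mdist X u v \<and>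
      mdist X u v \<le> (f(z := MAX x\<in>F. \<bar>mdist X z x - f x\<bar>)) u + (f(z := MAX x\<in>F. \<bar>mdist X z x - f x\<bar>)) v"
      unfolding e_def[symmetric]
      using le[of u] le[of v] ge[of u] ge[of v] f \<open>mdist X z z = 0\<close> F(5)
      by (auto simp: katetov_on_def mdist_commute abs_le_iff)
  qed
qed

text \<open>Iterating the correction gives points whose errors are below \<open>(1/2)^n\<close> and
  whose consecutive distances are below \<open>2 * (1/2)^n\<close>. The steps are summable, so the
  points form a Cauchy sequence, and its limit has error zero.\<close>

lemma mcomplete_approx_imp_extension_property:
  assumes X: "mcomplete_of X" "approx_extension_property X"
  shows "extension_property X"
  unfolding extension_property_def
proof (intro allI impI)
  fix F f assume *: "finite F \<and> F \<subseteq> mspace X \<and> katetov_on X F f"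
  interpret X: Metric_space "mspace X" "mdist X" by simp
  show "\<exists>z\<in>mspace X. \<forall>x\<in>F. mdist X z x = f x"
  proof (cases "F = {}")
    case True
    then show ?thesis
      using X(2)[unfolded approx_extension_property_def, rule_format, of F f 1] * by auto
  next
    case False
    let ?Q = "\<lambda>n z. z \<in> mspace X \<and> (\<forall>x\<in>F. \<bar>mdist X z x - f x\<bar> < (1/2)^n)"
    have start: "\<exists>z. ?Q 0 z"
      using X(2)[unfolded approx_extension_property_def, rule_format, of F f 1] * by auto
    have step: "\<exists>z'. ?Q (Suc n) z' \<and> mdist X z z' < 2 * (1/2)^n" if z: "?Q n z" for n z
    proof (cases "z \<in> F")
      case True
      \<comment> \<open>For \<open>z\<close> in \<open>F\<close> no new value can be prescribed at
        \<open>z\<close>. But \<open>mdist X z z = 0\<close> makes \<open>f z\<close> itself the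
        error at \<open>z\<close>, hence small, and every better solution lies close to
        \<open>z\<close>.\<close>
      have fz: "\<bar>f z\<bar> < (1/2)^n" using z True by (auto dest!: bspec[of _ _ z])
      obtain z' where z': "z' \<in> mspace X" "\<forall>x\<in>F. \<bar>mdist X z' x - f x\<bar> < (1/2)^Suc n"
        using X(2)[unfolded approx_extension_property_def, rule_format, of F f "(1/2)^Suc n"] * by auto
      have "mdist X z z' < 2 * (1/2)^n"
        using z'(2)[rule_format, OF True] fz by (simp add: mdist_commute abs_if split: if_splits)
      then show ?thesis using z' by blast
    next
      case zF: False
      define e where "e = (MAX x\<in>F. \<bar>mdist X z x - f x\<bar>)"
      have "katetov_on X (insert z F) (f(z := e))"
        unfolding e_def using * False z zF by (intro katetov_on_insert_error) auto
      then obtain z' where z': "z' \<in> mspace X"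
        "\<forall>x\<in>insert z F. \<bar>mdist X z' x - (f(z := e)) x\<bar> < (1/2)^Suc n"
        using X(2)[unfolded approx_extension_property_def, rule_format,
            of "insert z F" "f(z := e)" "(1/2)^Suc n"] * z by auto
      have "e < (1/2)^n" unfolding e_def using * False z by (subst Max_less_iff) auto
      with z'(2) have "mdist X z z' < 2 * (1/2)^n"
        by (auto simp: mdist_commute abs_if split: if_splits)
      moreover have "\<forall>x\<in>F. \<bar>mdist X z' x - f x\<bar> < (1/2)^Suc n"
        using z'(2) zF by (auto split: if_splits)
      ultimately show ?thesis using z' by blast
    qed
    obtain s where s: "\<And>n. ?Q n (s n)" "\<And>n. mdist X (s n) (s (Suc n)) < 2 * (1/2)^n"
      using dependent_nat_choice[of ?Q "\<lambda>n z z'. mdist X z z' < 2 * (1/2)^n"] start step by metis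
    \<comment> \<open>The partial sum of the geometric series of step bounds is kept exactly, which
      lets the induction close.\<close>
    have tele: "mdist X (s n) (s (n + k)) \<le> 4 * (1/2)^n - 4 * (1/2)^(n+k)" for n k
    proof (induction k)
      case 0 then show ?case using s(1)[of n] by simp
    next
      case (Suc k)
      have "mdist X (s n) (s (n + Suc k)) \<le> mdist X (s n) (s (n + k)) + mdist X (s (n+k)) (s (n + Suc k))"
        using s(1) by (intro mdist_triangle) auto
      with Suc s(2)[of "n+k"] show ?case by simp
    qed
    have tele': "mdist X (s m) (s n) \<le> 4 * (1/2)^N" if "N \<le> m" "N \<le> n" for m n N
    proof -
      have 1: "mdist X (s m) (s n) \<le> 4 * (1/2)^N" if "N \<le> m" "m \<le> n" for m n
      proof -
        have "(1/2::real)^m \<le> (1/2)^N" using that by (intro power_decreasing) auto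
        moreover have "0 \<le> (1/2::real)^n" by simp
        ultimately show ?thesis using tele[of m "n - m"] that by (simp only: le_add_diff_inverse)
      qed
      show ?thesis using 1[of m n] 1[of n m] that by (cases "m \<le> n") (auto simp: mdist_commute)
    qed
    have "X.MCauchy s"
      unfolding X.MCauchy_def
    proof (intro conjI allI impI)
      fix e :: real assume "e > 0"
      then obtain N where "(1/2::real)^N < e/4" using real_arch_pow_inv[of "e/4" "1/2"] by auto
      then have "mdist X (s m) (s n) < e" if "N \<le> m" "N \<le> n" for m n
        using tele'[OF that] by simp
      then show "\<exists>N. \<forall>n n'. N \<le> n \<longrightarrow> N \<le> n' \<longrightarrow> mdist X (s n) (s n') < e"
        by blast
    qed (use s in auto)
    then obtain l where l: "limitin X.mtopology s l sequentially"
      using X(1) by (auto simp: mcomplete_of_def X.mcomplete_def)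
    then have lM: "l \<in> mspace X" by (rule X.limitin_mspace)
    have "mdist X l x = f x" if x: "x \<in> F" for x
    proof (rule LIMSEQ_unique)
      have "(\<lambda>n. mdist X (s n) l) \<longlonglongrightarrow> 0"
        using l by (simp add: X.limitin_metric_dist_null)
      then have "(\<lambda>n. mdist X (s n) x - mdist X l x) \<longlonglongrightarrow> 0"
      proof (rule Lim_null_comparison[rotated], intro always_eventually allI)
        fix n show "norm (mdist X (s n) x - mdist X l x) \<le> mdist X (s n) l"
          using X.mdist_reverse_triangle[of "s n" x l] s(1)[of n] lM * x by (auto simp: mdist_commute)
      qed
      then show "(\<lambda>n. mdist X (s n) x) \<longlonglongrightarrow> mdist X l x" by (rule LIM_zero_cancel)
      have "(\<lambda>n. (1/2::real)^n) \<longlonglongrightarrow> 0" by (rule LIMSEQ_power_zero) simp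
      then have "(\<lambda>n. mdist X (s n) x - f x) \<longlonglongrightarrow> 0"
        by (rule Lim_null_comparison[rotated]) (use s x in \<open>auto intro!: always_eventually less_imp_le\<close>)
      then show "(\<lambda>n. mdist X (s n) x) \<longlonglongrightarrow> f x" by (rule LIM_zero_cancel)
    qed
    then show ?thesis using lM by blast
  qed
qed

text \<open>The finite set is approximated by points of the dense copy of the index set. Extending
  \<open>f\<close> first to a Katetov function \<open>g\<close> on all of \<open>Y\<close> makes the
  values of \<open>g\<close> on the copy an admissible vector, so universality supplies the point.
  The three errors \<open>\<epsilon> / 3\<close> come from moving the base point in the distance,
  moving it in \<open>g\<close>, and universality.\<close>

lemma completion_of_universal_extension_property:
  assumes r: "universal_matrix r" "Metric_space UNIV r" and Y: "is_completion (metric (UNIV, r)) Y"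
  shows "extension_property Y"
proof (rule mcomplete_approx_imp_extension_property)
  interpret R: Metric_space UNIV r by fact
  interpret Y: Metric_space "mspace Y" "mdist Y" by simp
  show "mcomplete_of Y" using Y by (simp add: is_completion_def)
  obtain p where p: "\<And>i. p i \<in> mspace Y" "\<And>i j. mdist Y (p i) (p j) = r i j"
    and dense: "Y.mtopology closure_of (range p) = mspace Y"
    using Y by (auto simp: is_completion_def isometric_embedding_def mtopology_of_def)
  have near: "\<exists>i. mdist Y x (p i) < e" if "x \<in> mspace Y" "e > 0" for x e
    using that dense by (auto simp: Y.metric_closure_of)
  show "approx_extension_property Y"
    unfolding approx_extension_property_def
  proof (intro allI impI)
    fix F f and \<epsilon> :: real
    assume *: "finite F \<and> F \<subseteq> mspace Y \<and> katetov_on Y F f \<and> 0 < \<epsilon>"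
    show "\<exists>z\<in>mspace Y. \<forall>x\<in>F. \<bar>mdist Y z x - f x\<bar> < \<epsilon>"
    proof (cases "F = {}")
      case True then show ?thesis using p by auto
    next
      case False
      obtain g where g: "katetov_on Y (mspace Y) g" "\<And>x. x \<in> F \<Longrightarrow> g x = f x"
        using katetov_extension * False by metis
      obtain i where i: "\<And>x. x \<in> F \<Longrightarrow> mdist Y x (p (i x)) < \<epsilon> / 3"
        using near[of _ "\<epsilon>/3"] * by (metis divide_pos_pos subsetD zero_less_numeral)
      \<comment> \<open>Universality speaks of initial segments of indices, so \<open>n\<close>
        exceeds every index chosen by \<open>i\<close>.\<close>
      define n where "n = Suc (Max (i ` F))"
      have n: "i x < n" if "x \<in> F" for x
        using * that by (simp add: n_def less_Suc_eq_le)
      have "(\<lambda>i. g (p i)) \<in> admissible_vectors n r"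
        using g(1) p(1) by (simp add: admissible_vectors_def katetov_on_def p(2)[symmetric])
      then obtain m where m: "\<And>i. i < n \<Longrightarrow> \<bar>r i m - g (p i)\<bar> < \<epsilon> / 3"
        using r(1) * unfolding universal_matrix_def by (metis divide_pos_pos zero_less_numeral)
      have "\<bar>mdist Y (p m) x - f x\<bar> < \<epsilon>" if x: "x \<in> F" for x
      proof -
        have xM: "x \<in> mspace Y" using * x by auto
        have "\<bar>mdist Y (p m) x - mdist Y (p m) (p (i x))\<bar> \<le> mdist Y x (p (i x))"
          using Y.mdist_reverse_triangle[of x "p m" "p (i x)"] xM p by (simp add: mdist_commute)
        moreover have "\<bar>g x - g (p (i x))\<bar> \<le> mdist Y x (p (i x))"
          using g(1) xM p by (auto simp: katetov_on_def)
        moreover have "mdist Y (p m) (p (i x)) = r (i x) m"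
          by (simp add: p R.commute)
        ultimately show ?thesis using m[OF n[OF x]] i[OF x] g(2)[OF x] by linarith
      qed
      then show ?thesis using p by blast
    qed
  qed
qed

section \<open>Back and forth\<close>

text \<open>Taken as a relation, so that going back is going forth for the converse. Equality of
  distances makes it single-valued in both directions, because distance zero means equality.\<close>

definition partial_isometry :: "'a metric \<Rightarrow> 'b metric \<Rightarrow> ('a \<times> 'b) set \<Rightarrow> bool" where
  "partial_isometry X Y P \<longleftrightarrow> P \<subseteq> mspace X \<times> mspace Y \<and>
     (\<forall>x y x' y'. (x, y) \<in> P \<longrightarrow> (x', y') \<in> P \<longrightarrow> mdist X x x' = mdist Y y y')"

lemma partial_isometryD:
  assumes "partial_isometry X Y P" "(x, y) \<in> P"
  shows "x \<in> mspace X" "y \<in> mspace Y" "(x', y') \<in> P \<Longrightarrow> mdist Y y y' = mdist X x x'"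
  using assms by (auto simp: partial_isometry_def)

lemma partial_isometry_converse [simp]:
  "partial_isometry Y X (P\<inverse>) \<longleftrightarrow> partial_isometry X Y P"
  unfolding partial_isometry_def by auto

text \<open>The distances from \<open>x\<close> to the domain, carried over to the range of
  \<open>P\<close>, form a Katetov function there. A point realising it is a legitimate image of
  \<open>x\<close>.\<close>

lemma partial_isometry_extend:
  assumes Y: "extension_property Y" and P: "partial_isometry X Y P" "finite P" and x: "x \<in> mspace X"
  shows "\<exists>y\<in>mspace Y. partial_isometry X Y (insert (x, y) P)"
proof -
  define g where "g y = (SOME u. (u, y) \<in> P)" for y
  have g: "g y = u" if "(u, y) \<in> P" for u y
  proof -
    have "(g y, y) \<in> P" unfolding g_def using that by (rule someI)
    then have "mdist X (g y) u = mdist Y y y" using partial_isometryD(3)[OF P(1) _ that] by simp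
    also have "\<dots> = 0" using partial_isometryD(2)[OF P(1) that] by simp
    finally show ?thesis
      using partial_isometryD(1)[OF P(1)] that \<open>(g y, y) \<in> P\<close> by (metis mdist_zero)
  qed
  have "katetov_on Y (snd ` P) (\<lambda>y. mdist X x (g y))"
    unfolding katetov_on_def
  proof (intro ballI)
    fix y y' assume "y \<in> snd ` P" "y' \<in> snd ` P"
    then obtain u u' where u: "(u, y) \<in> P" "(u', y') \<in> P" by auto
    note uM = partial_isometryD(1)[OF P(1) u(1)] partial_isometryD(1)[OF P(1) u(2)]
    have "mdist X x u \<le> mdist X x u' + mdist X u' u" "mdist X x u' \<le> mdist X x u + mdist X u u'"
      "mdist X u u' \<le> mdist X u x + mdist X x u'"
      using x uM by (auto intro!: mdist_triangle)
    then show "\<bar>mdist X x (g y) - mdist X x (g y')\<bar> \<le> mdist Y y y' \<and>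
        mdist Y y y' \<le> mdist X x (g y) + mdist X x (g y')"
      using g[OF u(1)] g[OF u(2)] partial_isometryD(3)[OF P(1) u] by (simp add: mdist_commute abs_le_iff)
  qed
  then obtain z where z: "z \<in> mspace Y" "\<And>y. y \<in> snd ` P \<Longrightarrow> mdist Y z y = mdist X x (g y)"
  proof -
    have "snd ` P \<subseteq> mspace Y" using P(1) by (auto simp: partial_isometry_def)
    then show thesis
      using that Y P(2) \<open>katetov_on Y _ _\<close> unfolding extension_property_def by (meson finite_imageI)
  qed
  have diag: "mdist X x x = mdist Y z z" using x z(1) by (metis mdist_zero)
  have zg: "mdist Y z y = mdist X x u" if "(u, y) \<in> P" for u y
    using z(2)[of y] g[OF that] that by force
  have zg': "mdist Y y z = mdist X u x" if "(u, y) \<in> P" for u y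
    using zg[OF that] by (simp add: mdist_commute)
  have "partial_isometry X Y (insert (x, z) P)"
    using P(1) x z(1) zg zg' diag
    unfolding partial_isometry_def by auto
  then show ?thesis using z(1) by blast
qed

lemma partial_isometry_Union_chain:
  assumes "\<And>n :: nat. partial_isometry X Y (S n)" "\<And>n. S n \<subseteq> S (Suc n)"
  shows "partial_isometry X Y (\<Union>n. S n)"
proof -
  have mono: "S m \<subseteq> S n" if "m \<le> n" for m n
    using assms(2) that by (rule lift_Suc_mono_le)
  show ?thesis
    unfolding partial_isometry_def
  proof (intro conjI allI impI)
    show "(\<Union>n. S n) \<subseteq> mspace X \<times> mspace Y"
      using assms(1) unfolding partial_isometry_def by blast
    fix x y x' y' assume "(x, y) \<in> (\<Union>n. S n)" "(x', y') \<in> (\<Union>n. S n)"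
    then obtain m n where "(x, y) \<in> S m" "(x', y') \<in> S n" by auto
    then have "(x, y) \<in> S (max m n)" "(x', y') \<in> S (max m n)"
      using mono by (meson max.cobounded1 max.cobounded2 subsetD)+
    then show "mdist X x x' = mdist Y y y'"
      using assms(1) partial_isometryD(3) by metis
  qed
qed

text \<open>With \<open>D = {}\<close> this is the one-sided construction, for which \<open>X\<close> may be arbitrary.\<close>

lemma back_and_forth:
  assumes Y: "extension_property Y" and X: "D = {} \<or> extension_property X"
    and P: "partial_isometry X Y P" "finite P"
    and C: "countable C" "C \<subseteq> mspace X" and D: "countable D" "D \<subseteq> mspace Y"
  obtains R where "P \<subseteq> R" "partial_isometry X Y R" "C \<subseteq> Domain R" "D \<subseteq> Range R"
proof -
  let ?I = "\<lambda>Q. P \<subseteq> Q \<and> finite Q \<and> partial_isometry X Y Q"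
  \<comment> \<open>Stage \<open>n\<close> absorbs the \<open>n\<close>-th point of each countable
    set. The guards are there because \<open>from_nat_into\<close> lies in the set only when the set
    is nonempty.\<close>
  let ?S = "\<lambda>n Q Q'. Q \<subseteq> Q' \<and> (C \<noteq> {} \<longrightarrow> from_nat_into C n \<in> Domain Q') \<and>
    (D \<noteq> {} \<longrightarrow> from_nat_into D n \<in> Range Q')"
  have step: "\<exists>Q'. ?I Q' \<and> ?S n Q Q'" if Q: "?I Q" for n Q
  proof -
    obtain Q1 where Q1: "?I Q1" "Q \<subseteq> Q1" "C \<noteq> {} \<longrightarrow> from_nat_into C n \<in> Domain Q1"
    proof (cases "C = {}")
      case True then show ?thesis using that Q by blast
    next
      case False
      then have "from_nat_into C n \<in> mspace X" using from_nat_into[of C n] C(2) by blast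
      then obtain y where "partial_isometry X Y (insert (from_nat_into C n, y) Q)"
        using partial_isometry_extend[OF Y, of X Q] Q by metis
      then show ?thesis using Q by (intro that[of "insert (from_nat_into C n, y) Q"]) auto
    qed
    show ?thesis
    proof (cases "D = {}")
      case True then show ?thesis using Q1 by blast
    next
      case False
      then have "from_nat_into D n \<in> mspace Y" using from_nat_into[of D n] D(2) by blast
      then obtain x where "partial_isometry Y X (insert (from_nat_into D n, x) (Q1\<inverse>))"
        using partial_isometry_extend[of X Y "Q1\<inverse>"] Q1(1) X False
        by (metis finite_converse partial_isometry_converse)
      moreover have "insert (from_nat_into D n, x) (Q1\<inverse>) = (insert (x, from_nat_into D n) Q1)\<inverse>"
        by auto
      ultimately have "partial_isometry X Y (insert (x, from_nat_into D n) Q1)"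
        by (metis partial_isometry_converse)
      then show ?thesis using Q1 by (intro exI[of _ "insert (x, from_nat_into D n) Q1"]) auto
    qed
  qed
  have "?I P" using P by auto
  then obtain S where S: "\<And>n. ?I (S n)" "\<And>n. ?S n (S n) (S (Suc n))"
    using dependent_nat_choice[of "\<lambda>n. ?I" ?S] step by metis
  show ?thesis
  proof (rule that)
    show "P \<subseteq> (\<Union>n. S n)" using S(1) by blast
    show "partial_isometry X Y (\<Union>n. S n)"
      using S by (intro partial_isometry_Union_chain) auto
    show "C \<subseteq> Domain (\<Union>n. S n)"
    proof
      fix c assume "c \<in> C"
      then obtain n where "from_nat_into C n = c" using from_nat_into_surj[OF C(1)] by auto
      then have "c \<in> Domain (S (Suc n))" using S(2)[of n] \<open>c \<in> C\<close> by auto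
      then show "c \<in> Domain (\<Union>n. S n)" by auto
    qed
    show "D \<subseteq> Range (\<Union>n. S n)"
    proof
      fix c assume "c \<in> D"
      then obtain n where "from_nat_into D n = c" using from_nat_into_surj[OF D(1)] by auto
      then have "c \<in> Range (S (Suc n))" using S(2)[of n] \<open>c \<in> D\<close> by auto
      then show "c \<in> Range (\<Union>n. S n)" by auto
    qed
  qed
qed

section \<open>Extension of partial isometries by density and completeness\<close>

lemma dense_near:
  assumes "mtopology_of X closure_of S = mspace X" "x \<in> mspace X" "e > 0"
  shows "\<exists>s\<in>S. mdist X x s < e"
proof -
  interpret X: Metric_space "mspace X" "mdist X" by simp
  show ?thesis
    using assms by (auto simp: X.metric_closure_of mtopology_of_def)
qed

text \<open>Approximate \<open>x\<close> by points of the dense domain. Their partners form a Cauchy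
  sequence because \<open>R\<close> preserves distances, and by continuity of the distance their
  limit has the right distance to each point of the range.\<close>

lemma partial_isometry_limit_point:
  assumes R: "partial_isometry X Y R" and dense: "mtopology_of X closure_of Domain R = mspace X"
    and Y: "mcomplete_of Y" and x: "x \<in> mspace X"
  shows "\<exists>z\<in>mspace Y. \<forall>(u, v)\<in>R. mdist Y z v = mdist X x u"
proof -
  interpret X: Metric_space "mspace X" "mdist X" by simp
  interpret Y: Metric_space "mspace Y" "mdist Y" by simp
  have near: "\<exists>u v. (u, v) \<in> R \<and> mdist X x u < e" if "e > 0" for e
    using dense_near[OF dense x that] by blast
  obtain u v where uv: "\<And>n. (u n, v n) \<in> R" "\<And>n :: nat. mdist X x (u n) < inverse (real (Suc n))"
    using near[of "inverse (real (Suc _))"] by (metis inverse_positive_iff_positive of_nat_0_less_iff zero_less_Suc)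
  note uvM = partial_isometryD(1,2)[OF R uv(1)]
  have lim: "(\<lambda>n. mdist X x (u n)) \<longlonglongrightarrow> 0"
    by (rule Lim_null_comparison[OF _ LIMSEQ_inverse_real_of_nat])
       (use uv in \<open>auto intro!: always_eventually less_imp_le\<close>)
  have "limitin X.mtopology u x sequentially"
    using lim uvM x by (simp add: X.limitin_metric_dist_null mdist_commute)
  then have "X.MCauchy u" using uvM by (intro X.convergent_imp_MCauchy) auto
  then have "Y.MCauchy v"
    using uvM partial_isometryD(3)[OF R uv(1) uv(1)] by (auto simp: X.MCauchy_def Y.MCauchy_def)
  then obtain z where z: "limitin Y.mtopology v z sequentially"
    using Y by (auto simp: mcomplete_of_def Y.mcomplete_def)
  then have zM: "z \<in> mspace Y" by (rule Y.limitin_mspace)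
  have limz: "(\<lambda>n. mdist Y (v n) z) \<longlonglongrightarrow> 0" using z by (simp add: Y.limitin_metric_dist_null)
  have "mdist Y z b = mdist X x a" if ab: "(a, b) \<in> R" for a b
  proof (rule LIMSEQ_unique)
    note abM = partial_isometryD(1,2)[OF R ab]
    have "(\<lambda>n. mdist Y (v n) b - mdist Y z b) \<longlonglongrightarrow> 0"
      using Y.mdist_reverse_triangle[of "v _" b z] uvM zM abM
      by (intro Lim_null_comparison[OF _ limz] always_eventually allI) (auto simp: mdist_commute)
    then show "(\<lambda>n. mdist Y (v n) b) \<longlonglongrightarrow> mdist Y z b" by (rule LIM_zero_cancel)
    have "(\<lambda>n. mdist X (u n) a - mdist X x a) \<longlonglongrightarrow> 0"
      using X.mdist_reverse_triangle[of "u _" a x] uvM x abM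
      by (intro Lim_null_comparison[OF _ lim] always_eventually allI) (auto simp: mdist_commute)
    then show "(\<lambda>n. mdist Y (v n) b) \<longlonglongrightarrow> mdist X x a"
      using partial_isometryD(3)[OF R uv(1) ab] by (simp add: LIM_zero_cancel)
  qed
  then show ?thesis using zM by blast
qed

text \<open>Each \<open>x\<close> goes to a point with the prescribed distances to the range.
  Replacing \<open>x'\<close> by a near point \<open>u\<close> of the domain, and
  \<open>g x'\<close> by the partner of \<open>u\<close>, changes either distance by at most
  \<open>mdist X x' u\<close>, so \<open>g\<close> preserves distances. The third conclusion serves
  the surjectivity argument later on.\<close>

lemma partial_isometry_dense_embedding:
  assumes R: "partial_isometry X Y R" and dense: "mtopology_of X closure_of Domain R = mspace X"
    and Y: "mcomplete_of Y"
  obtains g where "isometric_embedding X Y g" "\<And>u v. (u, v) \<in> R \<Longrightarrow> g u = v"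
    "\<And>x u v. x \<in> mspace X \<Longrightarrow> (u, v) \<in> R \<Longrightarrow> mdist Y (g x) v = mdist X x u"
proof -
  interpret X: Metric_space "mspace X" "mdist X" by simp
  interpret Y: Metric_space "mspace Y" "mdist Y" by simp
  have near: "\<exists>u v. (u, v) \<in> R \<and> mdist X x u < e" if "x \<in> mspace X" "e > 0" for x e
    using dense_near[OF dense that] by blast
  obtain g where g: "\<And>x. x \<in> mspace X \<Longrightarrow> g x \<in> mspace Y"
    "\<And>x u v. x \<in> mspace X \<Longrightarrow> (u, v) \<in> R \<Longrightarrow> mdist Y (g x) v = mdist X x u"
    using bchoice[of "mspace X" "\<lambda>x z. z \<in> mspace Y \<and> (\<forall>(u, v)\<in>R. mdist Y z v = mdist X x u)"]
      partial_isometry_limit_point[OF assms] by fastforce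
  have "mdist Y (g x) (g x') = mdist X x x'" if xM: "x \<in> mspace X" "x' \<in> mspace X" for x x'
  proof (rule ccontr)
    assume "mdist Y (g x) (g x') \<noteq> mdist X x x'"
    then have "\<bar>mdist Y (g x) (g x') - mdist X x x'\<bar> / 2 > 0" by simp
    then obtain u v where uv: "(u, v) \<in> R" "mdist X x' u < \<bar>mdist Y (g x) (g x') - mdist X x x'\<bar> / 2"
      using near[OF xM(2)] by blast
    note uvM = partial_isometryD(1,2)[OF R uv(1)]
    have "\<bar>mdist Y (g x) (g x') - mdist Y (g x) v\<bar> \<le> mdist Y (g x') v"
      using Y.mdist_reverse_triangle[of "g x'" "g x" v] g(1) xM uvM by (simp add: mdist_commute)
    moreover have "\<bar>mdist X x x' - mdist X x u\<bar> \<le> mdist X x' u"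
      using X.mdist_reverse_triangle[of x' x u] xM uvM by (simp add: mdist_commute)
    ultimately show False
      using uv(2) g(2)[OF xM(1) uv(1)] g(2)[OF xM(2) uv(1)] by (simp add: abs_if split: if_splits)
  qed
  then have "isometric_embedding X Y g" using g(1) by (auto simp: isometric_embedding_def)
  moreover have "g u = v" if "(u, v) \<in> R" for u v
  proof -
    have "mdist Y (g u) v = 0" using g(2)[OF _ that] partial_isometryD(1)[OF R that] by simp
    then show ?thesis using g(1) partial_isometryD[OF R that] by simp
  qed
  ultimately show ?thesis using that g(2) by blast
qed

text \<open>For surjectivity the limit point construction is applied to the converse relation: it
  gives \<open>x\<close> whose distances to the domain match those of \<open>y\<close> to the range.
  Then \<open>g x\<close> and \<open>y\<close> have equal distances to a dense set and must
  coincide.\<close>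

lemma partial_isometry_dense_isometry:
  assumes R: "partial_isometry X Y R" and X: "mcomplete_of X" and Y: "mcomplete_of Y"
    and dense: "mtopology_of X closure_of Domain R = mspace X" "mtopology_of Y closure_of Range R = mspace Y"
  obtains g where "isometry X Y g" "\<And>u v. (u, v) \<in> R \<Longrightarrow> g u = v"
proof -
  interpret Y: Metric_space "mspace Y" "mdist Y" by simp
  obtain g where g: "isometric_embedding X Y g" "\<And>u v. (u, v) \<in> R \<Longrightarrow> g u = v"
    "\<And>x u v. x \<in> mspace X \<Longrightarrow> (u, v) \<in> R \<Longrightarrow> mdist Y (g x) v = mdist X x u"
    using partial_isometry_dense_embedding[OF R dense(1) Y] by metis
  have gM: "g x \<in> mspace Y" if "x \<in> mspace X" for x
    using g(1) that by (auto simp: isometric_embedding_def)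
  have "y \<in> g ` mspace X" if y: "y \<in> mspace Y" for y
  proof -
    have "\<exists>x\<in>mspace X. \<forall>(v, u)\<in>R\<inverse>. mdist X x u = mdist Y y v"
      using R dense(2) X y by (intro partial_isometry_limit_point) auto
    then obtain x where x: "x \<in> mspace X" "\<And>u v. (u, v) \<in> R \<Longrightarrow> mdist X x u = mdist Y y v"
      by auto
    have "mdist Y (g x) y = 0"
    proof (rule ccontr)
      assume "mdist Y (g x) y \<noteq> 0"
      then have "mdist Y (g x) y / 2 > 0" by (simp add: less_le)
      then obtain u v where uv: "(u, v) \<in> R" "mdist Y y v < mdist Y (g x) y / 2"
        using dense_near[OF dense(2) y] by blast
      have "mdist Y (g x) y \<le> mdist Y (g x) v + mdist Y v y"
        using y gM[OF x(1)] partial_isometryD(2)[OF R uv(1)] by (intro mdist_triangle) auto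
      also have "\<dots> = 2 * mdist Y y v"
        using g(3)[OF x(1) uv(1)] x(2)[OF uv(1)] by (simp add: mdist_commute)
      finally show False using uv(2) by simp
    qed
    then show ?thesis using gM[OF x(1)] x(1) y by auto
  qed
  then have "isometry X Y g" using g(1) gM by (auto simp: isometry_def)
  with g(2) show ?thesis using that by blast
qed

section \<open>Complete separable spaces with the extension property\<close>

lemma dense_superset:
  assumes "mtopology_of X closure_of C = mspace X" "C \<subseteq> D" "D \<subseteq> mspace X"
  shows "mtopology_of X closure_of D = mspace X"
  using closure_of_mono[OF assms(2), of "mtopology_of X"] closure_of_subset_topspace[of "mtopology_of X" D] assms
  by auto

lemma isometry_extending_partial:
  assumes X: "mcomplete_of X" "separable_space (mtopology_of X)" "extension_property X"
    and Y: "mcomplete_of Y" "separable_space (mtopology_of Y)" "extension_property Y"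
    and P: "partial_isometry X Y P" "finite P"
  shows "\<exists>g. isometry X Y g \<and> (\<forall>(u, v)\<in>P. g u = v)"
proof -
  obtain C where C: "countable C" "C \<subseteq> mspace X" "mtopology_of X closure_of C = mspace X"
    using X(2) by (auto simp: separable_space_def)
  obtain D where D: "countable D" "D \<subseteq> mspace Y" "mtopology_of Y closure_of D = mspace Y"
    using Y(2) by (auto simp: separable_space_def)
  obtain R where R: "P \<subseteq> R" "partial_isometry X Y R" "C \<subseteq> Domain R" "D \<subseteq> Range R"
    using back_and_forth[OF Y(3) _ P C(1,2) D(1,2)] X(3) by metis
  have "Domain R \<subseteq> mspace X" "Range R \<subseteq> mspace Y"
    using R(2) by (auto simp: partial_isometry_def)
  then obtain g where "isometry X Y g" "\<And>u v. (u, v) \<in> R \<Longrightarrow> g u = v"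
    using partial_isometry_dense_isometry[OF R(2) X(1) Y(1)] dense_superset[OF C(3) R(3)]
      dense_superset[OF D(3) R(4)] by metis
  then show ?thesis using R(1) by blast
qed

text \<open>Going forth only, from the empty relation: the points of a countable dense set of
  \<open>X\<close> receive images one by one, and completeness of \<open>Y\<close> extends the
  result to all of \<open>X\<close>.\<close>

lemma isometric_embedding_separable:
  assumes X: "separable_space (mtopology_of X)" and Y: "mcomplete_of Y" "extension_property Y"
  shows "\<exists>g. isometric_embedding X Y g"
proof -
  obtain C where C: "countable C" "C \<subseteq> mspace X" "mtopology_of X closure_of C = mspace X"
    using X by (auto simp: separable_space_def)
  have "partial_isometry X Y {}" by (simp add: partial_isometry_def)
  then obtain R where R: "partial_isometry X Y R" "C \<subseteq> Domain R"
    using back_and_forth[of Y "{}" X "{}" C] Y C by auto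
  have "Domain R \<subseteq> mspace X"
    using R by (auto simp: partial_isometry_def)
  then show ?thesis
    by (rule partial_isometry_dense_embedding[OF R(1) dense_superset[OF C(3) R(2)] Y(1)]) (rule exI)
qed

lemma urysohn_space_if_extension_property:
  assumes U: "mcomplete_of U" "separable_space (mtopology_of U)" "extension_property U"
  shows "urysohn_space U"
  unfolding urysohn_space_def
proof (intro conjI allI impI)
  fix A B h
  assume *: "finite A \<and> A \<subseteq> mspace U \<and> finite B \<and> B \<subseteq> mspace U \<and>
    isometry (submetric U A) (submetric U B) h"
  \<comment> \<open>The graph of the finite isometry \<open>h\<close> is the starting relation for a
    back-and-forth of \<open>U\<close> with itself.\<close>
  have "partial_isometry U U ((\<lambda>x. (x, h x)) ` A)"
    unfolding partial_isometry_def
  proof (intro conjI allI impI subsetI)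
    have h: "h x \<in> B" "mdist U (h x) (h y) = mdist U x y" if "x \<in> A" "y \<in> A" for x y
      using * that by (auto simp: isometry_def isometric_embedding_def Int_absorb2 Pi_iff)
    show "p \<in> mspace U \<times> mspace U" if "p \<in> (\<lambda>x. (x, h x)) ` A" for p
      using * h(1) that by auto
    show "mdist U x x' = mdist U y y'"
      if "(x, y) \<in> (\<lambda>x. (x, h x)) ` A" "(x', y') \<in> (\<lambda>x. (x, h x)) ` A" for x y x' y'
      using h(2) that by auto
  qed
  moreover have "finite ((\<lambda>x. (x, h x)) ` A)" using * by simp
  ultimately have "\<exists>g. isometry U U g \<and> (\<forall>(u, v)\<in>(\<lambda>x. (x, h x)) ` A. g u = v)"
    by (rule isometry_extending_partial[OF U U])
  then show "\<exists>g. isometry U U g \<and> (\<forall>x\<in>A. g x = h x)" by (simp add: ball_simps)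
qed (use U isometric_embedding_separable in auto)

lemma isometric_spaces_if_extension_property:
  assumes "mcomplete_of X" "separable_space (mtopology_of X)" "extension_property X"
    and "mcomplete_of Y" "separable_space (mtopology_of Y)" "extension_property Y"
  shows "isometric_spaces X Y"
  using isometry_extending_partial[OF assms, of "{}"]
  by (auto simp: partial_isometry_def isometric_spaces_def)

lemma separable_completion_of_countable:
  assumes "is_completion X Y" "countable (mspace X)"
  shows "separable_space (mtopology_of Y)"
proof -
  obtain f where "f \<in> mspace X \<rightarrow> mspace Y" "mtopology_of Y closure_of (f ` mspace X) = mspace Y"
    using assms(1) by (auto simp: is_completion_def isometric_embedding_def)
  then show ?thesis
    using assms(2) unfolding separable_space_def by (intro exI[of _ "f ` mspace X"]) auto
qed

section \<open>Conditioning on the earlier entries\<close>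

context Ionescu_Tulcea
begin

text \<open>\<open>C 0 n (\<lambda>_. undefined)\<close> is the joint law of the first
  \<open>n\<close> entries, started from the only point of the empty product. It is the marginal of
  the limit because \<open>CI\<close> on an initial segment is \<open>C\<close> itself.\<close>

lemma nn_integral_lim_restrict:
  assumes f: "f \<in> borel_measurable (PiM {0..<n} M)"
  shows "(\<integral>\<^sup>+x. f (restrict x {0..<n}) \<partial>PF.lim) = (\<integral>\<^sup>+x. f x \<partial>C 0 n (\<lambda>_. undefined))"
proof -
  have u: "(\<lambda>_. undefined) \<in> space (PiM {0..<0} M)" by (simp add: space_PiM)
  have "up_to {0..<n} = n"
    using up_to[of "{0..<n}"] by (intro antisym) (auto simp: up_to_iff)
  then have CI: "CI {0..<n} = C 0 n (\<lambda>_. undefined)"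
    using distr_C[OF order_refl u, of n] by (simp add: CI_def)
  have "(\<integral>\<^sup>+x. f (restrict x {0..<n}) \<partial>PF.lim) =
      (\<integral>\<^sup>+x. f x \<partial>distr PF.lim (PiM {0..<n} M) (\<lambda>x. restrict x {0..<n}))"
  proof (rule nn_integral_distr[symmetric])
    show "(\<lambda>x. restrict x {0..<n}) \<in> measurable PF.lim (PiM {0..<n} M)"
      unfolding measurable_cong_sets[OF PF.sets_lim refl] by (rule measurable_restrict_subset) simp
  qed (use f in simp)
  also have "\<dots> = (\<integral>\<^sup>+x. f x \<partial>C 0 n (\<lambda>_. undefined))"
    by (subst distr_lim) (simp_all add: CI)
  finally show ?thesis .
qed

text \<open>Tower property: the law of the first \<open>Suc n\<close> entries is the law of the
  first \<open>n\<close> followed by the kernel \<open>P n\<close>. Both sides are written over the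
  limit measure, so that everything refers to one probability space.\<close>

lemma nn_integral_lim_Suc:
  assumes f[measurable]: "f \<in> borel_measurable (PiM {0..<Suc n} M)"
  shows "(\<integral>\<^sup>+x. f (restrict x {0..<Suc n}) \<partial>PF.lim) =
    (\<integral>\<^sup>+x. \<integral>\<^sup>+y. f ((restrict x {0..<n})(n := y)) \<partial>P n (restrict x {0..<n}) \<partial>PF.lim)"
proof -
  have u: "(\<lambda>_. undefined) \<in> space (PiM {0..<0} M)" by (simp add: space_PiM)
  have "(\<integral>\<^sup>+x. f (restrict x {0..<Suc n}) \<partial>PF.lim) = (\<integral>\<^sup>+x. f x \<partial>C 0 (Suc n) (\<lambda>_. undefined))"
    by (rule nn_integral_lim_restrict[OF f])
  also have "\<dots> = (\<integral>\<^sup>+x. \<integral>\<^sup>+y. f y \<partial>eP n x \<partial>C 0 n (\<lambda>_. undefined))"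
    using u measurable_eP[of n]
    by (simp, subst nn_integral_bind[where B="PiM {0..<Suc n} M"])
       (auto simp: measurable_cong_sets[OF sets_C[OF u] refl])
  also have "\<dots> = (\<integral>\<^sup>+x. \<integral>\<^sup>+y. f y \<partial>eP n (restrict x {0..<n}) \<partial>PF.lim)"
    by (rule nn_integral_lim_restrict[symmetric])
       (rule measurable_compose[OF measurable_eP nn_integral_measurable_subprob_algebra], simp)
  also have "\<dots> = (\<integral>\<^sup>+x. \<integral>\<^sup>+y. f ((restrict x {0..<n})(n := y)) \<partial>P n (restrict x {0..<n}) \<partial>PF.lim)"
  proof (rule nn_integral_cong)
    fix x assume "x \<in> space PF.lim"
    then have "restrict x {0..<n} \<in> space (PiM {0..<n} M)"
      by (simp add: PF.space_lim space_PiM PiE_iff)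
    then show "(\<integral>\<^sup>+y. f y \<partial>eP n (restrict x {0..<n})) =
        (\<integral>\<^sup>+y. f ((restrict x {0..<n})(n := y)) \<partial>P n (restrict x {0..<n}))"
      by (intro nn_integral_eP) auto
  qed
  finally show ?thesis .
qed

text \<open>The total mass is read off the marginal on the empty index set.\<close>

lemma prob_space_lim: "prob_space PF.lim"
proof -
  have "distr PF.lim (PiM {} M) (\<lambda>x. restrict x {}) = CI {}"
    by (rule distr_lim) simp
  then have "prob_space (distr PF.lim (PiM {} M) (\<lambda>x. restrict x {}))"
    by (simp add: PF.prob_space_P)
  then show ?thesis
    by (rule prob_space_distrD[rotated])
       (auto simp: measurable_cong_sets[OF PF.sets_lim refl] intro!: measurable_restrict)
qed

end

section \<open>The enumeration of the entries, column by column\<close>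

lemma triangle_mono: "m \<le> n \<Longrightarrow> triangle m \<le> triangle n"
  by (rule lift_Suc_mono_le[of triangle]) auto

lemma triangle_add_less: "i \<le> m \<Longrightarrow> m < n \<Longrightarrow> triangle m + i < triangle n"
  using triangle_mono[of "Suc m" n] by simp

text \<open>\<open>triangle N\<close> counts the entries of the columns \<open>1\<close> to
  \<open>N\<close>, so column \<open>Suc N\<close> starts at position \<open>triangle N\<close> and
  has \<open>Suc N\<close> entries.\<close>

lemma matrix_of_seq_Suc: "i \<le> N \<Longrightarrow> matrix_of_seq x i (Suc N) = x (triangle N + i)"
  by (simp add: matrix_of_seq_def prod_encode_def)

lemma matrix_of_seq_sym: "matrix_of_seq x i j = matrix_of_seq x j i"
  by (simp add: matrix_of_seq_def)

lemma matrix_of_seq_diag [simp]: "matrix_of_seq x i i = 0"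
  by (simp add: matrix_of_seq_def)

lemma ex_triangle_add: obtains N k where "k \<le> N" "t = triangle N + k"
proof -
  obtain k d where "t = prod_encode (k, d)"
    by (metis prod_decode_inverse surj_pair)
  then have "t = triangle (k + d) + k" by (simp add: prod_encode_def)
  then show ?thesis using that[of k "k + d"] by simp
qed

lemma entry_kernel_triangle:
  assumes "k \<le> N"
  shows "entry_kernel \<gamma> (triangle N + k) x =
    (let r = matrix_of_seq x in
      if k = 0 then \<gamma>
      else uniform_interval (MAX i\<in>{..<k}. \<bar>r i k - r i (Suc N)\<bar>) (MIN i\<in>{..<k}. r i k + r i (Suc N)))"
proof -
  have "triangle N + k = prod_encode (k, N - k)"
    using assms by (simp add: prod_encode_def)
  moreover have "k + (N - k) = N" using assms by simp
  ultimately show ?thesis by (simp only: entry_kernel_def prod_encode_inverse prod.case Let_def Suc_eq_plus1)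
qed

text \<open>The corner with indices up to \<open>n\<close> involves only the columns up to
  \<open>n\<close>, and these fill the positions below \<open>triangle n\<close>.\<close>

lemma matrix_of_seq_cong:
  assumes "\<And>s. s < triangle n \<Longrightarrow> x s = y s" "i \<le> n" "j \<le> n"
  shows "matrix_of_seq x i j = matrix_of_seq y i j"
proof -
  have *: "matrix_of_seq x i j = matrix_of_seq y i j" if "i < j" "j \<le> n" for i j
  proof (cases j)
    case (Suc N)
    then show ?thesis using that assms(1)[of "triangle N + i"] triangle_add_less[of i N n]
      by (simp add: matrix_of_seq_Suc)
  qed (use that in simp)
  show ?thesis
    using *[of i j] *[of j i] assms(2,3)
    by (cases i j rule: linorder_cases) (auto simp: matrix_of_seq_sym[of _ i j])
qed

text \<open>The kernel for row \<open>k\<close> of column \<open>Suc N\<close> reads the upper parts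
  of columns \<open>k\<close> and \<open>Suc N\<close>, both earlier since \<open>k \<le> N\<close>.
  Kernels can therefore be evaluated at full sequences instead of restricted ones.\<close>

lemma entry_kernel_cong:
  assumes "\<And>s. s < t \<Longrightarrow> x s = y s"
  shows "entry_kernel \<gamma> t x = entry_kernel \<gamma> t y"
proof -
  obtain N k where t: "k \<le> N" "t = triangle N + k" by (rule ex_triangle_add)
  have 1: "matrix_of_seq x i (Suc N) = matrix_of_seq y i (Suc N)" if "i < k" for i
    using that t assms by (simp add: matrix_of_seq_Suc)
  have 2: "matrix_of_seq x i k = matrix_of_seq y i k" if "i < k" for i
    using that t assms by (intro matrix_of_seq_cong[of N]) auto
  show ?thesis
    unfolding t(2) entry_kernel_triangle[OF t(1)] Let_def using 1 2
    by (auto intro!: arg_cong2[of _ _ _ _ uniform_interval] arg_cong[of _ _ Max] arg_cong[of _ _ Min])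
qed

lemma measurable_matrix_of_seq [measurable]:
  "(\<lambda>x. matrix_of_seq x i j) \<in> borel_measurable (PiM UNIV (\<lambda>_. borel))"
  by (simp add: matrix_of_seq_def measurable_component_singleton)

text \<open>A coordinate outside \<open>I\<close> is constantly \<open>undefined\<close> on the
  product over \<open>I\<close>, hence measurable. Functions of full sequences thus become
  measurable on the finite stages.\<close>

lemma measurable_PiM_UNIV_ident:
  "(\<lambda>x. x) \<in> measurable (PiM I (\<lambda>_. borel)) (PiM UNIV (\<lambda>_. borel :: real measure))"
proof (rule measurable_PiM_single')
  fix i show "(\<lambda>x. x i) \<in> borel_measurable (PiM I (\<lambda>_. borel :: real measure))"
  proof (cases "i \<in> I")
    case False
    have "(\<lambda>x. x i) \<in> borel_measurable (PiM I (\<lambda>_. borel :: real measure)) \<longleftrightarrow>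
        (\<lambda>x. undefined :: real) \<in> borel_measurable (PiM I (\<lambda>_. borel :: real measure))"
      using False by (intro measurable_cong) (auto simp: space_PiM PiE_iff extensional_def)
    then show ?thesis by simp
  qed (simp add: measurable_component_singleton)
qed auto

text \<open>Together with measurability this plays the role of adaptedness to the first
  \<open>t\<close> entries, phrased for functions of full sequences so that no restriction maps
  appear.\<close>

definition depends_below :: "nat \<Rightarrow> ((nat \<Rightarrow> real) \<Rightarrow> 'a) \<Rightarrow> bool" where
  "depends_below t f \<longleftrightarrow> (\<forall>x y. (\<forall>s<t. x s = y s) \<longrightarrow> f x = f y)"

lemma depends_belowD: "depends_below t f \<Longrightarrow> (\<And>s. s < t \<Longrightarrow> x s = y s) \<Longrightarrow> f x = f y"
  by (simp add: depends_below_def)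

lemma depends_below_mono: "depends_below s f \<Longrightarrow> s \<le> t \<Longrightarrow> depends_below t f"
  by (simp add: depends_below_def)

lemma depends_below_not: "depends_below t f \<Longrightarrow> depends_below t (\<lambda>x. \<not> f x)"
  unfolding depends_below_def by presburger

lemma depends_below_conj:
  assumes "depends_below t f" "depends_below t g"
  shows "depends_below t (\<lambda>x. f x \<and> g x)"
  unfolding depends_below_def
proof (intro allI impI)
  fix x y :: "nat \<Rightarrow> real" assume "\<forall>s<t. x s = y s"
  then have "f x = f y" "g x = g y"
    using depends_belowD[OF assms(1), of x y] depends_belowD[OF assms(2), of x y] by simp_all
  then show "(f x \<and> g x) = (f y \<and> g y)" by simp
qed

lemma depends_below_indicator:
  assumes "depends_below t f"
  shows "depends_below t (indicator {x. f x} :: _ \<Rightarrow> ennreal)"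
  unfolding depends_below_def
proof (intro allI impI)
  fix x y :: "nat \<Rightarrow> real" assume "\<forall>s<t. x s = y s"
  then have "f x = f y" using depends_belowD[OF assms, of x y] by simp
  then show "indicator {x. f x} x = (indicator {x. f x} y :: ennreal)" by (simp add: indicator_def)
qed

section \<open>One-step conditioning for the random matrix\<close>

locale random_matrix =
  fixes \<gamma> :: "real measure"
  assumes prob_space_\<gamma>: "prob_space \<gamma>" and sets_\<gamma> [measurable_cong]: "sets \<gamma> = sets borel"
begin

sublocale IT: Ionescu_Tulcea "entry_kernel \<gamma>" "\<lambda>_. borel"
  using prob_space_\<gamma> sets_\<gamma> by (rule Ionescu_Tulcea_entry_kernel)

abbreviation "\<Omega> \<equiv> PiM UNIV (\<lambda>_. borel) :: (nat \<Rightarrow> real) measure"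
abbreviation "L \<equiv> IT.PF.lim"

sublocale L: prob_space L
  by (rule IT.prob_space_lim)

lemma sets_L [measurable_cong]: "sets L = sets \<Omega>"
  by simp

lemma space_L [simp]: "space L = UNIV"
  by (simp add: IT.PF.space_lim space_PiM)

lemma sets_Collect_pred:
  assumes "Measurable.pred \<Omega> \<phi>"
  shows "{x. \<phi> x} \<in> sets \<Omega>" "{x. \<not> \<phi> x} \<in> sets \<Omega>"
proof -
  have sp: "space \<Omega> = UNIV" by (simp add: space_PiM)
  show 1: "{x. \<phi> x} \<in> sets \<Omega>"
    using assms unfolding pred_def sp by simp
  have "{x. \<not> \<phi> x} = space \<Omega> - {x. \<phi> x}" using sp by blast
  then show "{x. \<not> \<phi> x} \<in> sets \<Omega>"
    using sets.compl_sets[OF 1] by (simp only:)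
qed

lemma sets_entry_kernel [measurable_cong]: "sets (entry_kernel \<gamma> t x) = sets borel"
  using sets_\<gamma> by (auto simp: entry_kernel_def Let_def uniform_interval_def split: prod.split)

text \<open>The tower property without restrictions: \<open>f\<close> ignores the entries after
  \<open>t\<close>, and the kernel ignores those from \<open>t\<close> on.\<close>

lemma nn_integral_step:
  assumes f: "f \<in> borel_measurable \<Omega>" "depends_below (Suc t) f"
  shows "(\<integral>\<^sup>+x. f x \<partial>L) = (\<integral>\<^sup>+x. \<integral>\<^sup>+y. f (x(t := y)) \<partial>entry_kernel \<gamma> t x \<partial>L)"
proof -
  have 1: "f (restrict x {0..<Suc t}) = f x" for x
    using f(2) unfolding depends_below_def by auto
  have 2: "f ((restrict x {0..<t})(t := y)) = f (x(t := y))" for x y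
    using f(2) unfolding depends_below_def by auto
  have 3: "entry_kernel \<gamma> t (restrict x {0..<t}) = entry_kernel \<gamma> t x" for x
    by (rule entry_kernel_cong) simp
  have "f \<in> borel_measurable (PiM {0..<Suc t} (\<lambda>_. borel))"
    using measurable_compose[OF measurable_PiM_UNIV_ident f(1)] .
  from IT.nn_integral_lim_Suc[OF this] show ?thesis
    unfolding 1 2 3 .
qed

text \<open>The probability of the exceptional set is the integral of its conditional probabilities,
  all zero. The last premise ranges over every earlier sequence, so conditions on the earlier
  entries have to be built into \<open>\<phi>\<close> as premises.\<close>

lemma AE_step:
  assumes \<phi>: "Measurable.pred \<Omega> \<phi>" and dep: "depends_below (Suc t) \<phi>"
    and AE: "\<And>x. AE y in entry_kernel \<gamma> t x. \<phi> (x(t := y))"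
  shows "AE x in L. \<phi> x"
proof (rule AE_I)
  have S: "{x. \<not> \<phi> x} \<in> sets \<Omega>"
    using \<phi> by (rule sets_Collect_pred)
  have "emeasure L {x. \<not> \<phi> x} = (\<integral>\<^sup>+x. indicator {x. \<not> \<phi> x} x \<partial>L)"
    using S by (intro nn_integral_indicator[symmetric]) (simp only: sets_L)
  also have "\<dots> = (\<integral>\<^sup>+x. \<integral>\<^sup>+y. indicator {x. \<not> \<phi> x} (x(t := y)) \<partial>entry_kernel \<gamma> t x \<partial>L)"
  proof (rule nn_integral_step)
    show "indicator {x. \<not> \<phi> x} \<in> borel_measurable \<Omega>" using S by (rule borel_measurable_indicator)
    show "depends_below (Suc t) (indicator {x. \<not> \<phi> x} :: _ \<Rightarrow> ennreal)"
      by (intro depends_below_indicator depends_below_not dep)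
  qed
  also have "\<dots> = (\<integral>\<^sup>+x. \<integral>\<^sup>+y. 0 \<partial>entry_kernel \<gamma> t x \<partial>L)"
  proof (rule nn_integral_cong, rule nn_integral_cong_AE)
    fix x show "AE y in entry_kernel \<gamma> t x. indicator {x. \<not> \<phi> x} (x(t := y)) = (0::ennreal)"
      using AE[of x] by eventually_elim simp
  qed
  finally show "emeasure L {x. \<not> \<phi> x} = 0" by simp
  show "{x. \<not> \<phi> x} \<in> sets L" using S by (simp only: sets_L)
  show "{x \<in> space L. \<not> \<phi> x} \<subseteq> {x. \<not> \<phi> x}" by blast
qed

text \<open>The lower bound for the conditional probability of \<open>H\<close> is integrated over
  the event \<open>A\<close>, which is decided before entry \<open>t\<close>.\<close>

lemma prob_step_ge:
  assumes A: "Measurable.pred \<Omega> A" "depends_below t A"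
    and H: "Measurable.pred \<Omega> H" "depends_below (Suc t) H"
    and c: "c \<ge> 0" "\<And>x. A x \<Longrightarrow> ennreal c \<le> emeasure (entry_kernel \<gamma> t x) {y. H (x(t := y))}"
  shows "c * L.prob {x. A x} \<le> L.prob {x. A x \<and> H x}"
proof -
  have "Measurable.pred \<Omega> (\<lambda>x. A x \<and> H x)"
    by (rule pred_intros_logic(3)[OF A(1) H(1)])
  note S = sets_Collect_pred(1)[OF A(1)] sets_Collect_pred(1)[OF this]
  have Aupd: "A (x(t := y)) = A x" for x y
    using A(2) unfolding depends_below_def by auto
  have Hm: "{y. H (x(t := y))} \<in> sets (entry_kernel \<gamma> t x)" for x
  proof -
    have "(\<lambda>y. x(t := y)) \<in> measurable borel \<Omega>"
      by (rule measurable_PiM_single') (auto simp: fun_upd_def)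
    from measurable_compose[OF this H(1)] show ?thesis by (simp add: sets_entry_kernel pred_def)
  qed
  have "ennreal (c * L.prob {x. A x}) = ennreal c * emeasure L {x. A x}"
    using c by (simp add: ennreal_mult L.emeasure_eq_measure)
  also have "\<dots> = (\<integral>\<^sup>+x. ennreal c * indicator {x. A x} x \<partial>L)"
    using S(1) by (intro nn_integral_cmult_indicator[symmetric]) (simp only: sets_L)
  also have "\<dots> \<le> (\<integral>\<^sup>+x. \<integral>\<^sup>+y. indicator {x. A x \<and> H x} (x(t := y)) \<partial>entry_kernel \<gamma> t x \<partial>L)"
  proof (rule nn_integral_mono)
    fix x
    show "ennreal c * indicator {x. A x} x \<le>
        (\<integral>\<^sup>+y. indicator {x. A x \<and> H x} (x(t := y)) \<partial>entry_kernel \<gamma> t x)"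
    proof (cases "A x")
      case True
      have "(\<integral>\<^sup>+y. indicator {x. A x \<and> H x} (x(t := y)) \<partial>entry_kernel \<gamma> t x) =
          (\<integral>\<^sup>+y. indicator {y. H (x(t := y))} y \<partial>entry_kernel \<gamma> t x)"
        using True by (intro nn_integral_cong) (simp add: Aupd indicator_def)
      then show ?thesis using True c(2)[OF True] Hm[of x] by simp
    qed simp
  qed
  also have "\<dots> = (\<integral>\<^sup>+x. indicator {x. A x \<and> H x} x \<partial>L)"
  proof (rule nn_integral_step[symmetric])
    show "indicator {x. A x \<and> H x} \<in> borel_measurable \<Omega>" using S(2) by (rule borel_measurable_indicator)
    show "depends_below (Suc t) (indicator {x. A x \<and> H x} :: _ \<Rightarrow> ennreal)"
      by (intro depends_below_indicator depends_below_conj H(2) depends_below_mono[OF A(2)]) simp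
  qed
  also have "\<dots> = emeasure L {x. A x \<and> H x}"
    using S(2) by (intro nn_integral_indicator) (simp only: sets_L)
  also have "\<dots> = ennreal (L.prob {x. A x \<and> H x})"
    by (simp add: L.emeasure_eq_measure)
  finally show ?thesis by simp
qed

end

section \<open>Distance matrices\<close>

lemma emeasure_uniform_interval_ge:
  assumes "l \<le> a - \<eta>" "a + \<eta> \<le> u" "u - l \<le> w" "\<eta> > 0"
  shows "ennreal (2 * \<eta> / w) \<le> emeasure (uniform_interval l u) {y. \<bar>y - a\<bar> < \<eta>}"
proof -
  have lu: "l < u" using assms by linarith
  have S: "{y. \<bar>y - a\<bar> < \<eta>} = {a - \<eta><..<a + \<eta>}" by auto
  have I: "{l..u} \<inter> {a - \<eta><..<a + \<eta>} = {a - \<eta><..<a + \<eta>}" using assms by auto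
  have "emeasure (uniform_interval l u) {y. \<bar>y - a\<bar> < \<eta>} =
      emeasure lborel {a - \<eta><..<a + \<eta>} / emeasure lborel {l..u}"
    using lu by (simp add: uniform_interval_def S I)
  also have "\<dots> = ennreal (2 * \<eta>) / ennreal (u - l)"
    using lu assms by simp
  also have "\<dots> = ennreal (2 * \<eta> / (u - l))"
    using lu assms by (subst divide_ennreal) auto
  also have "\<dots> \<ge> ennreal (2 * \<eta> / w)"
    using lu assms by (intro ennreal_leI divide_left_mono) auto
  finally show ?thesis .
qed

lemma AE_uniform_interval: "l \<le> u \<Longrightarrow> AE y in uniform_interval l u. l \<le> y \<and> y \<le> u"
  unfolding uniform_interval_def
  by (auto intro!: AE_uniform_measureI simp: AE_return)

text \<open>The deterministic part: if every entry lies in its interval whenever that interval is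
  nonempty, then by induction all intervals are nonempty and the triangle inequality holds. The
  outer induction runs over the columns, the inner one down a column. Strict positivity comes from
  the first row, whose off-diagonal entries are positive and pairwise distinct.\<close>

lemma matrix_of_seq_distance_matrix:
  assumes row0: "\<And>N. x (triangle N) > 0" "\<And>m N. m < N \<Longrightarrow> x (triangle N) \<noteq> x (triangle m)"
    and rows: "\<And>N k. \<lbrakk>0 < k; k \<le> N;
        \<And>i j. i < k \<Longrightarrow> j < k \<Longrightarrow>
          \<bar>matrix_of_seq x i k - x (triangle N + i)\<bar> \<le> matrix_of_seq x j k + x (triangle N + j)\<rbrakk> \<Longrightarrow>
        \<forall>i<k. \<bar>matrix_of_seq x i k - x (triangle N + i)\<bar> \<le> x (triangle N + k) \<and>
          x (triangle N + k) \<le> matrix_of_seq x i k + x (triangle N + i)"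
  shows "matrix_of_seq x \<in> distance_matrices" "i \<noteq> j \<Longrightarrow> matrix_of_seq x i j > 0"
proof -
  define r where "r = matrix_of_seq x"
  have sym: "r i j = r j i" for i j unfolding r_def by (rule matrix_of_seq_sym)
  have diag: "r i i = 0" for i by (simp add: r_def)
  have col: "r i (Suc N) = x (triangle N + i)" if "i \<le> N" for i N
    using that by (simp add: r_def matrix_of_seq_Suc)
  have tri_less: "r i k \<le> r i j + r j k \<and> r i j \<le> r i k + r j k \<and> r j k \<le> r i j + r i k"
    if "i < j" "j < k" for i j k
    using that
  proof (induction k arbitrary: i j rule: less_induct)
    case (less n)
    then obtain N where n: "n = Suc N" by (cases n) auto
    have tri: "r a c \<le> r a b + r b c" if "a < n" "b < n" "c < n" "a \<noteq> b" "b \<noteq> c" "a \<noteq> c" for a b c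
      using that less.IH[of c a b] less.IH[of c b a] less.IH[of b a c] less.IH[of b c a]
        less.IH[of a b c] less.IH[of a c b]
      by (auto simp: sym neq_iff)
    \<comment> \<open>Row \<open>j\<close> of column \<open>n\<close> against all rows above it; the
      columns before \<open>n\<close> already satisfy the triangle inequality by the outer
      induction.\<close>
    have step: "\<forall>i<j. \<bar>r i j - r i n\<bar> \<le> r j n \<and> r j n \<le> r i j + r i n" if "j < n" for j
      using that
    proof (induction j rule: less_induct)
      case (less k)
      show ?case
      proof (cases "k = 0")
        case False
        \<comment> \<open>Nonemptiness of the interval for row \<open>k\<close>. For
          \<open>i \<noteq> j\<close> the triangle \<open>i, j, n\<close> from the inner induction
          is combined with the triangle \<open>i, j, k\<close> from the outer one. For
          \<open>i = j\<close> the claim amounts to nonnegativity of the two entries.\<close>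
        have "\<bar>r i k - r i n\<bar> \<le> r j k + r j n" if "i < k" "j < k" for i j
        proof -
          consider "i = j" | "i < j" | "j < i" by linarith
          then show ?thesis
          proof cases
            case 1
            have "r i k \<ge> 0 \<and> r i n \<ge> 0"
            proof (cases "i = 0")
              case True
              then show ?thesis using row0(1)[of N] row0(1)[of "k - 1"] False n col[of 0 N] col[of 0 "k - 1"]
                by (simp add: less_imp_le)
            next
              case i: False
              then have "\<bar>r 0 i - r 0 n\<bar> \<le> r i n" using less.IH[of i] that(1) less.prems by auto
              moreover have "r i k \<ge> 0"
                using tri[of i k 0] tri[of 0 k i] tri[of i 0 k] tri[of 0 i k] that less.prems False i sym by fastforce
              ultimately show ?thesis by linarith
            qed
            with 1 show ?thesis by (auto simp: abs_le_iff)
          next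
            case 2
            have "\<bar>r i j - r i n\<bar> \<le> r j n \<and> r j n \<le> r i j + r i n"
              using less.IH[OF that(2)] less.prems that(2) 2 by simp
            moreover have "r i k \<le> r i j + r j k" "r i j \<le> r i k + r k j"
              using tri[of i k j] tri[of i j k] 2 that less.prems by auto
            ultimately show ?thesis using sym[of k j] by linarith
          next
            case 3
            have "\<bar>r j i - r j n\<bar> \<le> r i n \<and> r i n \<le> r j i + r j n"
              using less.IH[OF that(1)] less.prems that(1) 3 by simp
            moreover have "r i k \<le> r i j + r j k" "r j i \<le> r j k + r k i"
              using tri[of i j k] tri[of j k i] 3 that less.prems by auto
            ultimately show ?thesis using sym[of k i] sym[of i j] by linarith
          qed
        qed
        then show ?thesis
          using rows[of k N] False less.prems by (simp add: n r_def[symmetric] col)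
      qed simp
    qed
    show ?case using step[of j] less.prems by (auto simp: sym)
  qed
  have pos_less: "r i j > 0" if "i < j" for i j
  proof (cases "i = 0")
    case True
    then show ?thesis using row0(1)[of "j - 1"] col[of 0 "j - 1"] that by simp
  next
    case False
    have "r 0 i \<noteq> r 0 j"
      using row0(2)[OF diff_less_mono[OF that, of 1], THEN not_sym]
        col[of 0 "i - 1"] col[of 0 "j - 1"] False that
      by simp
    then show ?thesis using tri_less[of 0 i j] False that by auto
  qed
  show pos: "i \<noteq> j \<Longrightarrow> matrix_of_seq x i j > 0" for i j
    using pos_less[of i j] pos_less[of j i] sym[of i j] by (auto simp: r_def[symmetric] neq_iff)
  have tri: "r i j \<le> r i k + r k j" for i j k
  proof (cases "i = j \<or> j = k \<or> i = k")
    case True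
    have "r a b \<ge> 0" for a b using pos[of a b] by (cases "a = b") (auto simp: r_def less_imp_le)
    then show ?thesis using True by (auto simp: diag sym)
  next
    case False
    then show ?thesis
      using tri_less[of i j k] tri_less[of i k j] tri_less[of j i k] tri_less[of j k i]
        tri_less[of k i j] tri_less[of k j i]
      by (auto simp: sym neq_iff)
  qed
  have "r i j \<ge> 0" for i j using pos[of i j] by (cases "i = j") (auto simp: r_def less_imp_le)
  then show "matrix_of_seq x \<in> distance_matrices"
    using tri diag sym unfolding r_def[symmetric] distance_matrices_def by blast
qed

text \<open>By second countability (Lindelof) the complement of the support is covered by countably
  many null open sets.\<close>

lemma AE_support:
  fixes M :: "'a::second_countable_topology measure"
  assumes "sets M = sets borel"
  shows "AE x in M. x \<in> measure_support M"
proof -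
  define \<U> where "\<U> = {U. open U \<and> emeasure M U = 0}"
  obtain \<V> where V: "\<V> \<subseteq> \<U>" "countable \<V>" "\<Union>\<V> = \<Union>\<U>"
    using Lindelof[of \<U>] by (auto simp: \<U>_def)
  have "(\<Union>U\<in>\<V>. U) \<in> null_sets M"
    using V assms by (intro null_sets_UN') (auto simp: \<U>_def null_sets_def subset_iff)
  then have "AE x in M. x \<notin> \<Union>\<V>"
    by (intro AE_not_in) simp
  then show ?thesis
  proof eventually_elim
    case (elim x)
    have "x \<notin> U" if "open U" "emeasure M U = 0" for U
      using that elim V by (auto simp: \<U>_def)
    then show ?case by (auto simp: measure_support_def zero_less_iff_neq_zero)
  qed
qed

section \<open>A countable form of universality\<close>

lemma measurable_Pi_real_component [measurable]:
  "(\<lambda>x. x i) \<in> borel_measurable (PiM UNIV (\<lambda>_. borel :: real measure))"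
  by (rule measurable_component_singleton) simp

lemma pred_All_less:
  fixes N :: nat
  assumes "\<And>m. m < N \<Longrightarrow> Measurable.pred M (\<lambda>x. P x m)"
  shows "Measurable.pred M (\<lambda>x. \<forall>m<N. P x m)"
proof -
  have "Measurable.pred M (\<lambda>x. \<forall>m\<in>{..<N}. P x m)"
    by (rule pred_intros_countable_bounded(3)) (simp add: assms)
  then show ?thesis by (simp only: Ball_def lessThan_iff)
qed

text \<open>Admissibility with slack \<open>2 * \<eta>\<close>: one \<open>\<eta>\<close> absorbs an
  error in an earlier row, the other is left as room around the target. Diagonal pairs are excluded,
  since for \<open>i = j\<close> a positive slack contradicts \<open>r i i = 0\<close>.\<close>

definition margin :: "nat \<Rightarrow> (nat \<Rightarrow> real) \<Rightarrow> real \<Rightarrow> (nat \<Rightarrow> nat \<Rightarrow> real) \<Rightarrow> bool" where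
  "margin n a \<eta> r \<longleftrightarrow>
     (\<forall>i<n. \<forall>j<n. i \<noteq> j \<longrightarrow> \<bar>a i - a j\<bar> + 2 * \<eta> \<le> r i j \<and> r i j + 2 * \<eta> \<le> a i + a j)"

text \<open>Move \<open>a\<close> slightly towards the constant vector \<open>D\<close>. Differences
  shrink by the factor \<open>1 - s\<close>, and sums gain because \<open>2 * D\<close> exceeds
  every off-diagonal entry by at least \<open>D\<close>. Rounding up to rationals then spends only
  part of the slack.\<close>

lemma admissible_perturb_margin:
  assumes r: "r \<in> distance_matrices" "\<And>i j. i \<noteq> j \<Longrightarrow> r i j > 0"
    and a: "a \<in> admissible_vectors n r" and \<epsilon>: "\<epsilon> > 0"
  shows "\<exists>(q :: rat list) m. length q = n \<and> (\<forall>i<n. q ! i \<ge> 0) \<and>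
    margin n (\<lambda>i. real_of_rat (q ! i)) (inverse (real (Suc m))) r \<and>
    (\<forall>i<n. \<bar>a i - real_of_rat (q ! i)\<bar> < \<epsilon>) \<and> inverse (real (Suc m)) < \<epsilon>"
proof -
  define I where "I = {..<n} \<times> {..<n} - Id"
  \<comment> \<open>Bounds for the off-diagonal entries of the corner and for the components of
    \<open>a\<close>; the inserted \<open>1\<close> makes the sets nonempty and gives
    \<open>D \<ge> 1\<close> and \<open>K \<ge> 1\<close>.\<close>
  define \<mu> where "\<mu> = Min (insert 1 ((\<lambda>(i, j). r i j) ` I))"
  define D where "D = Max (insert 1 ((\<lambda>(i, j). r i j) ` I))"
  define K where "K = Max (insert 1 (a ` {..<n}))"
  have fin: "finite I" by (simp add: I_def)
  have \<mu>: "\<mu> > 0" unfolding \<mu>_def using fin r(2) by (subst Min_gr_iff) (auto simp: I_def)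
  have \<mu>_le: "\<mu> \<le> r i j" if "i < n" "j < n" "i \<noteq> j" for i j
    unfolding \<mu>_def using fin that by (intro Min_le) (auto simp: I_def)
  have D_ge: "r i j \<le> D" if "i < n" "j < n" "i \<noteq> j" for i j
    unfolding D_def using fin that by (intro Max_ge) (auto simp: I_def)
  have D1: "D \<ge> 1" unfolding D_def using fin by (intro Max_ge) auto
  have K1: "K \<ge> 1" unfolding K_def by (intro Max_ge) auto
  have K_ge: "a i \<le> K" if "i < n" for i unfolding K_def using that by (intro Max_ge) auto
  have a0: "0 \<le> a i" if "i < n" for i
  proof -
    have "r i i \<le> a i + a i" using a that unfolding admissible_vectors_def by blast
    moreover have "r i i = 0" using r(1) unfolding distance_matrices_def by blast
    ultimately show ?thesis by linarith
  qed
  \<comment> \<open>\<open>s * (D + K)\<close> bounds the displacement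
    \<open>\<bar>a i - b i\<bar>\<close>, while the slack gained is
    \<open>s * \<mu>\<close>.\<close>
  define s where "s = min (1/2) (\<epsilon> / (4 * (D + K)))"
  have s: "0 < s" "s \<le> 1/2" "s * (D + K) \<le> \<epsilon> / 4"
  proof -
    show "0 < s" using \<epsilon> D1 K1 by (simp add: s_def)
    show "s \<le> 1/2" unfolding s_def by (rule min.cobounded1)
    have "s * (D + K) \<le> \<epsilon> / (4 * (D + K)) * (D + K)"
      using D1 K1 by (intro mult_right_mono) (auto simp: s_def)
    moreover
    have "\<epsilon> / (4 * W) * W = \<epsilon> / 4" if "W > 0" for W using that by simp
    from this[of "D + K"] have "\<epsilon> / (4 * (D + K)) * (D + K) = \<epsilon> / 4" using D1 K1 by linarith
    ultimately show "s * (D + K) \<le> \<epsilon> / 4" by linarith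
  qed
  define b where "b i = (1 - s) * a i + s * D" for i
  \<comment> \<open>Half of the slack \<open>s * \<mu>\<close> pays for rounding, the other half for
    the margin \<open>2 * inverse (real (Suc m))\<close>. The rationals are taken above
    \<open>b\<close>, so sums do not drop and components stay nonnegative.\<close>
  define \<theta> where "\<theta> = min (s * \<mu> / 2) (\<epsilon> / 3)"
  have \<theta>: "\<theta> > 0" using s \<mu> \<epsilon> by (simp add: \<theta>_def)
  have "\<exists>q. b i < real_of_rat q \<and> real_of_rat q < b i + \<theta>" for i
    using of_rat_dense[of "b i" "b i + \<theta>"] \<theta> by auto
  then obtain f where f: "\<And>i. b i < real_of_rat (f i)" "\<And>i. real_of_rat (f i) < b i + \<theta>"
    by metis
  obtain m where m: "inverse (real (Suc m)) < min (s * \<mu> / 4) (\<epsilon> / 3)"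
    using reals_Archimedean[of "min (s * \<mu> / 4) (\<epsilon> / 3)"] s \<mu> \<epsilon> by auto
  have b0: "0 \<le> b i" if "i < n" for i
    using a0[OF that] s D1 by (simp add: b_def)
  have b_close: "\<bar>a i - b i\<bar> \<le> \<epsilon> / 4" if "i < n" for i
  proof -
    have "a i - b i = s * (a i - D)" by (simp add: b_def algebra_simps)
    then have "\<bar>a i - b i\<bar> = s * \<bar>a i - D\<bar>" using s(1) by (simp add: abs_mult)
    also have "\<dots> \<le> s * (D + K)"
      using a0[OF that] K_ge[OF that] s D1 by (intro mult_left_mono) auto
    finally show ?thesis using s by linarith
  qed
  have b_diff: "\<bar>b i - b j\<bar> + s * \<mu> \<le> r i j \<and> r i j + s * \<mu> \<le> b i + b j"
    if ij: "i < n" "j < n" "i \<noteq> j" for i j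
  proof -
    have A: "\<bar>a i - a j\<bar> \<le> r i j" "r i j \<le> a i + a j"
      using a ij by (auto simp: admissible_vectors_def)
    have "\<bar>b i - b j\<bar> = (1 - s) * \<bar>a i - a j\<bar>"
      using s by (simp add: b_def abs_mult flip: right_diff_distrib)
    also have "\<dots> \<le> (1 - s) * r i j" using A s by (intro mult_left_mono) auto
    finally have 1: "\<bar>b i - b j\<bar> \<le> r i j - s * r i j" by (simp add: algebra_simps)
    have 2: "s * \<mu> \<le> s * r i j" using \<mu>_le[OF ij] s by simp
    have 3: "s * r i j \<le> s * D" using D_ge[OF ij] s by simp
    have "(1 - s) * r i j \<le> (1 - s) * (a i + a j)" using A s by (intro mult_left_mono) auto
    then have 4: "r i j - s * r i j + 2 * (s * D) \<le> b i + b j"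
      by (simp add: b_def algebra_simps)
    show ?thesis using 1 2 3 4 by linarith
  qed
  show ?thesis
  proof (intro exI[of _ "map f [0..<n]"] exI[of _ m] conjI)
    show "\<forall>i<n. map f [0..<n] ! i \<ge> 0"
    proof (intro allI impI)
      fix i assume "i < n"
      then have "real_of_rat (f i) \<ge> 0" using b0[of i] f(1)[of i] by linarith
      with \<open>i < n\<close> show "map f [0..<n] ! i \<ge> 0" by simp
    qed
    have \<theta>': "\<theta> \<le> s * \<mu> / 2" by (simp add: \<theta>_def)
    show "margin n (\<lambda>i. real_of_rat (map f [0..<n] ! i)) (inverse (real (Suc m))) r"
      unfolding margin_def
    proof (intro allI impI)
      fix i j assume ij: "i < n" "j < n" "i \<noteq> j"
      have "\<bar>real_of_rat (f i) - real_of_rat (f j)\<bar> \<le> \<bar>b i - b j\<bar> + \<theta>"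
        using f[of i] f[of j] by linarith
      then show "\<bar>real_of_rat (map f [0..<n] ! i) - real_of_rat (map f [0..<n] ! j)\<bar> + 2 * inverse (real (Suc m)) \<le> r i j \<and>
        r i j + 2 * inverse (real (Suc m)) \<le> real_of_rat (map f [0..<n] ! i) + real_of_rat (map f [0..<n] ! j)"
        using ij m b_diff[OF ij] \<theta>' f(1)[of i] f(1)[of j] \<theta> by (simp del: of_nat_Suc)
    qed
    show "\<forall>i<n. \<bar>a i - real_of_rat (map f [0..<n] ! i)\<bar> < \<epsilon>"
    proof (intro allI impI)
      fix i assume that: "i < n"
      have "\<theta> \<le> \<epsilon> / 3" by (simp add: \<theta>_def)
      then have "\<bar>a i - real_of_rat (f i)\<bar> < \<epsilon>"
        using b_close[OF that] f[of i] \<epsilon> by linarith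
      then show "\<bar>a i - real_of_rat (map f [0..<n] ! i)\<bar> < \<epsilon>" using that by simp
    qed
    show "inverse (real (Suc m)) < \<epsilon>" using m \<epsilon> by simp
  qed simp
qed

text \<open>A countable, hence measurable, form of universality.\<close>

definition rationally_universal :: "(nat \<Rightarrow> nat \<Rightarrow> real) \<Rightarrow> bool" where
  "rationally_universal r \<longleftrightarrow> r \<in> distance_matrices \<and> (\<forall>i j. i \<noteq> j \<longrightarrow> r i j > 0) \<and>
     (\<forall>(q :: rat list) m. (\<forall>i<length q. q ! i \<ge> 0) \<longrightarrow>
        margin (length q) (\<lambda>i. real_of_rat (q ! i)) (inverse (real (Suc m))) r \<longrightarrow>
        (\<exists>l. \<forall>i<length q. \<bar>r i l - real_of_rat (q ! i)\<bar> < inverse (real (Suc m))))"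

text \<open>Half of \<open>\<epsilon>\<close> is spent on replacing \<open>a\<close> by a rational
  vector with a margin, half on the column that comes near that vector.\<close>

lemma rationally_universal_imp_universal:
  assumes "rationally_universal r"
  shows "universal_matrix r"
proof -
  have r: "r \<in> distance_matrices" "\<And>i j. i \<noteq> j \<Longrightarrow> r i j > 0"
    and hit: "\<And>(q :: rat list) m. \<lbrakk>\<forall>i<length q. q ! i \<ge> 0;
        margin (length q) (\<lambda>i. real_of_rat (q ! i)) (inverse (real (Suc m))) r\<rbrakk> \<Longrightarrow>
      \<exists>l. \<forall>i<length q. \<bar>r i l - real_of_rat (q ! i)\<bar> < inverse (real (Suc m))"
    using assms unfolding rationally_universal_def by blast+
  show ?thesis
    unfolding universal_matrix_def
  proof (intro conjI allI impI ballI r(1))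
    fix \<epsilon> :: real and n a assume \<epsilon>: "0 < \<epsilon>" and a: "a \<in> admissible_vectors n r"
    have "\<epsilon> / 2 > 0" using \<epsilon> by simp
    then obtain q :: "rat list" and m where q: "length q = n" "\<forall>i<n. q ! i \<ge> 0"
      "margin n (\<lambda>i. real_of_rat (q ! i)) (inverse (real (Suc m))) r"
      "\<And>i. i < n \<Longrightarrow> \<bar>a i - real_of_rat (q ! i)\<bar> < \<epsilon> / 2" "inverse (real (Suc m)) < \<epsilon> / 2"
      using admissible_perturb_margin[OF r a, of "\<epsilon> / 2"] by blast
    then obtain l where l: "\<And>i. i < n \<Longrightarrow> \<bar>r i l - real_of_rat (q ! i)\<bar> < inverse (real (Suc m))"
      using hit[of q m] by auto
    have "\<bar>r i l - a i\<bar> < \<epsilon>" if "i < n" for i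
      using l[OF that] q(4)[OF that] q(5) by linarith
    then show "\<exists>m. \<forall>i<n. \<bar>r i m - a i\<bar> < \<epsilon>" by blast
  qed
qed

lemma borel_measurable_entry: "(\<lambda>r. r i j) \<in> borel_measurable (borel :: (nat \<Rightarrow> nat \<Rightarrow> real) measure)"
proof (rule borel_measurable_continuous_onI)
  have "continuous_on UNIV (\<lambda>r :: nat \<Rightarrow> nat \<Rightarrow> real. r i)"
    by (rule continuous_on_product_then_coordinatewise) (rule continuous_on_id)
  then show "continuous_on UNIV (\<lambda>r :: nat \<Rightarrow> nat \<Rightarrow> real. r i j)"
    by (rule continuous_on_product_then_coordinatewise)
qed

lemma pred_rationally_universal: "Measurable.pred borel rationally_universal"
  unfolding rationally_universal_def distance_matrices_def margin_def mem_Collect_eq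
  by (intro pred_intros_logic(3) pred_intros_countable pred_intros_imp' pred_intros_logic(4) pred_All_less;
      unfold pred_def; intro borel_measurable_le borel_measurable_less borel_measurable_eq
        borel_measurable_abs borel_measurable_diff borel_measurable_add borel_measurable_const
        borel_measurable_entry)

section \<open>Almost sure properties of the random matrix\<close>

context random_matrix
begin

text \<open>Given its predecessors, a first-row entry has law \<open>\<gamma>\<close>. Being
  atomless, this law avoids \<open>0\<close> and the finitely many earlier values, and it is carried
  by its support.\<close>

lemma AE_first_row:
  assumes atomless: "\<And>x. emeasure \<gamma> {x} = 0" and supp: "measure_support \<gamma> \<subseteq> {0..}"
  shows "AE x in L. x (triangle N) > 0 \<and> (\<forall>m<N. x (triangle N) \<noteq> x (triangle m))"
proof (rule AE_step[where t="triangle N"])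
  show "depends_below (Suc (triangle N))
      (\<lambda>x. 0 < x (triangle N) \<and> (\<forall>m<N. x (triangle N) \<noteq> x (triangle m)))"
    using triangle_mono[OF less_imp_le] by (auto simp: depends_below_def less_Suc_eq_le)
  fix x :: "nat \<Rightarrow> real"
  have K: "entry_kernel \<gamma> (triangle N) x = \<gamma>"
    using entry_kernel_triangle[of 0 N \<gamma> x] by (simp add: Let_def)
  have ne: "AE y in \<gamma>. y \<noteq> z" for z
    using atomless[of z] sets_\<gamma> by (intro AE_I[where N="{z}"]) auto
  have "AE y in \<gamma>. y \<noteq> 0 \<and> (\<forall>m\<in>{..<N}. y \<noteq> x (triangle m)) \<and> y \<in> measure_support \<gamma>"
    using ne AE_support[OF sets_\<gamma>] by (auto simp: AE_ball_countable)
  then show "AE y in entry_kernel \<gamma> (triangle N) x. 0 < (x(triangle N := y)) (triangle N) \<and>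
      (\<forall>m<N. (x(triangle N := y)) (triangle N) \<noteq> (x(triangle N := y)) (triangle m))"
    unfolding K
  proof eventually_elim
    case (elim y)
    have "triangle m \<noteq> triangle N" if "m < N" for m
      using triangle_add_less[of 0 m N] that by simp
    then show ?case using elim supp by auto
  qed
qed (intro pred_intros_logic(3,4) pred_All_less;
  unfold pred_def; intro borel_measurable_le borel_measurable_less borel_measurable_neq
    borel_measurable_abs borel_measurable_diff borel_measurable_add borel_measurable_const
    measurable_matrix_of_seq measurable_Pi_real_component)

text \<open>The premise says that the interval of the kernel is nonempty. Where it holds, the kernel
  is concentrated on that interval; elsewhere the implication is vacuous. This is the form that
  one-step conditioning demands.\<close>

lemma AE_lower_rows:
  assumes k: "0 < k" "k \<le> N"
  shows "AE x in L. (\<forall>i<k. \<forall>j<k.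
      \<bar>matrix_of_seq x i k - x (triangle N + i)\<bar> \<le> matrix_of_seq x j k + x (triangle N + j)) \<longrightarrow>
    (\<forall>i<k. \<bar>matrix_of_seq x i k - x (triangle N + i)\<bar> \<le> x (triangle N + k) \<and>
      x (triangle N + k) \<le> matrix_of_seq x i k + x (triangle N + i))"
    (is "AE x in L. ?\<phi> x")
proof (rule AE_step[where t="triangle N + k"])
  have cong: "matrix_of_seq x i k = matrix_of_seq y i k"
    if "\<And>s. s < triangle N + k \<Longrightarrow> x s = y s" "i < k" for x y i
    using that k by (intro matrix_of_seq_cong[of N]) simp_all
  show "depends_below (Suc (triangle N + k)) ?\<phi>"
    unfolding depends_below_def
  proof (intro allI impI)
    fix x y :: "nat \<Rightarrow> real" assume eq: "\<forall>s<Suc (triangle N + k). x s = y s"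
    have 1: "matrix_of_seq x i k = matrix_of_seq y i k" if "i < k" for i
      using eq that by (intro cong) auto
    have 2: "x (triangle N + i) = y (triangle N + i)" if "i \<le> k" for i
      using eq that by simp
    show "?\<phi> x = ?\<phi> y" by (simp add: 1 2)
  qed
  fix x :: "nat \<Rightarrow> real"
  have cong': "matrix_of_seq (x(triangle N + k := y)) i k = matrix_of_seq x i k" if "i < k" for i y
    using that by (intro cong) auto
  show "AE y in entry_kernel \<gamma> (triangle N + k) x. ?\<phi> (x(triangle N + k := y))"
  proof (cases "\<forall>i<k. \<forall>j<k.
      \<bar>matrix_of_seq x i k - x (triangle N + i)\<bar> \<le> matrix_of_seq x j k + x (triangle N + j)")
    case True
    let ?l = "MAX i\<in>{..<k}. \<bar>matrix_of_seq x i k - x (triangle N + i)\<bar>"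
    let ?u = "MIN i\<in>{..<k}. matrix_of_seq x i k + x (triangle N + i)"
    have K: "entry_kernel \<gamma> (triangle N + k) x = uniform_interval ?l ?u"
      unfolding entry_kernel_triangle[OF k(2)] Let_def using k
      by (auto intro!: arg_cong2[of _ _ _ _ uniform_interval] arg_cong[of _ _ Max] arg_cong[of _ _ Min]
          simp: matrix_of_seq_Suc)
    have "?l \<le> ?u"
      by (intro Max.boundedI Min.boundedI) (use k True in auto)
    then have "AE y in entry_kernel \<gamma> (triangle N + k) x. ?l \<le> y \<and> y \<le> ?u"
      unfolding K by (rule AE_uniform_interval)
    then show ?thesis
    proof eventually_elim
      case (elim y)
      have "\<bar>matrix_of_seq x i k - x (triangle N + i)\<bar> \<le> ?l"
        "?u \<le> matrix_of_seq x i k + x (triangle N + i)" if "i < k" for i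
        using that by (auto intro!: Max_ge Min_le)
      then have "\<bar>matrix_of_seq x i k - x (triangle N + i)\<bar> \<le> y \<and>
          y \<le> matrix_of_seq x i k + x (triangle N + i)" if "i < k" for i
        using elim that by (meson order_trans)
      then show ?case by (simp add: cong')
    qed
  next
    case False
    then show ?thesis by (intro AE_I2) (auto simp: cong')
  qed
qed (intro pred_intros_logic(3,4) pred_All_less;
  unfold pred_def; intro borel_measurable_le borel_measurable_less borel_measurable_neq
    borel_measurable_abs borel_measurable_diff borel_measurable_add borel_measurable_const
    measurable_matrix_of_seq measurable_Pi_real_component)

lemma AE_distance_matrix:
  assumes "\<And>x. emeasure \<gamma> {x} = 0" "measure_support \<gamma> \<subseteq> {0..}"
  shows "AE x in L. matrix_of_seq x \<in> distance_matrices \<and> (\<forall>i j. i \<noteq> j \<longrightarrow> matrix_of_seq x i j > 0)"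
proof -
  have "AE x in L. \<forall>N. x (triangle N) > 0 \<and> (\<forall>m<N. x (triangle N) \<noteq> x (triangle m))"
    using AE_first_row[OF assms] by (simp add: AE_all_countable)
  moreover have "AE x in L. \<forall>k N. 0 < k \<longrightarrow> k \<le> N \<longrightarrow> (\<forall>i<k. \<forall>j<k.
      \<bar>matrix_of_seq x i k - x (triangle N + i)\<bar> \<le> matrix_of_seq x j k + x (triangle N + j)) \<longrightarrow>
    (\<forall>i<k. \<bar>matrix_of_seq x i k - x (triangle N + i)\<bar> \<le> x (triangle N + k) \<and>
      x (triangle N + k) \<le> matrix_of_seq x i k + x (triangle N + i))"
    unfolding AE_all_countable
  proof (intro allI)
    fix k N
    show "AE x in L. 0 < k \<longrightarrow> k \<le> N \<longrightarrow> (\<forall>i<k. \<forall>j<k.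
      \<bar>matrix_of_seq x i k - x (triangle N + i)\<bar> \<le> matrix_of_seq x j k + x (triangle N + j)) \<longrightarrow>
    (\<forall>i<k. \<bar>matrix_of_seq x i k - x (triangle N + i)\<bar> \<le> x (triangle N + k) \<and>
      x (triangle N + k) \<le> matrix_of_seq x i k + x (triangle N + i))"
      using AE_lower_rows[of k N] by (cases "0 < k \<and> k \<le> N") auto
  qed
  ultimately show ?thesis
  proof eventually_elim
    case (elim x)
    have "matrix_of_seq x \<in> distance_matrices" "i \<noteq> j \<Longrightarrow> matrix_of_seq x i j > 0" for i j
      by (rule matrix_of_seq_distance_matrix; use elim in blast)+
    then show ?case by blast
  qed
qed

text \<open>Lower bound for the conditional probability that row \<open>k\<close> lands within
  \<open>\<eta>\<close> of its target. For \<open>k > 0\<close> it is a quotient of lengths: under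
  the margin and the hits above, \<open>2 * a 0 + a k\<close> dominates the upper end of the
  interval, and \<open>+ 1\<close> keeps the denominator positive.\<close>

definition entry_bound :: "(nat \<Rightarrow> real) \<Rightarrow> real \<Rightarrow> nat \<Rightarrow> real" where
  "entry_bound a \<eta> k =
     (if k = 0 then measure \<gamma> {y. \<bar>y - a 0\<bar> < \<eta>} else 2 * \<eta> / (2 * a 0 + a k + 1))"

text \<open>\<open>N\<close> refers to column \<open>Suc N\<close>; for \<open>n \<le> Suc N\<close>
  its first \<open>n\<close> rows lie above the diagonal.\<close>

definition hit :: "nat \<Rightarrow> (nat \<Rightarrow> real) \<Rightarrow> real \<Rightarrow> nat \<Rightarrow> (nat \<Rightarrow> real) \<Rightarrow> bool" where
  "hit n a \<eta> N x \<longleftrightarrow> (\<forall>k<n. \<bar>x (triangle N + k) - a k\<bar> < \<eta>)"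

text \<open>The earlier entries of the column are within \<open>\<eta>\<close> of their targets and
  the margin is \<open>2 * \<eta>\<close>, so every constraint on row \<open>k\<close> leaves the
  \<open>\<eta>\<close>-neighbourhood of \<open>a k\<close> inside the interval. The constraint from
  row \<open>0\<close> bounds the length.\<close>

lemma emeasure_entry_kernel_ge:
  assumes kN: "k < n" "k \<le> N" "n \<le> Suc N" and \<eta>: "\<eta> > 0"
    and r: "margin n a \<eta> (matrix_of_seq x)" and hit: "hit k a \<eta> N x"
  shows "ennreal (entry_bound a \<eta> k) \<le> emeasure (entry_kernel \<gamma> (triangle N + k) x) {y. \<bar>y - a k\<bar> < \<eta>}"
proof (cases "k = 0")
  case True
  interpret \<gamma>: prob_space \<gamma> by (rule prob_space_\<gamma>)
  show ?thesis
    unfolding entry_kernel_triangle[OF kN(2)] Let_def entry_bound_def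
    using True by (simp add: \<gamma>.emeasure_eq_measure)
next
  case False
  let ?r = "matrix_of_seq x"
  let ?l = "MAX i\<in>{..<k}. \<bar>?r i k - ?r i (Suc N)\<bar>"
  let ?u = "MIN i\<in>{..<k}. ?r i k + ?r i (Suc N)"
  have ne: "{..<k} \<noteq> {}" "finite {..<k}" using False by auto
  have near: "\<bar>?r i (Suc N) - a i\<bar> < \<eta>" if "i < k" for i
    using hit that kN by (simp add: hit_def matrix_of_seq_Suc)
  have m: "\<bar>a i - a k\<bar> + 2 * \<eta> \<le> ?r i k" "?r i k + 2 * \<eta> \<le> a i + a k" if "i < k" for i
    using r that kN unfolding margin_def by (auto dest: spec[of _ i])
  have l: "?l \<le> a k - \<eta>"
  proof (rule Max.boundedI)
    fix v assume "v \<in> (\<lambda>i. \<bar>?r i k - ?r i (Suc N)\<bar>) ` {..<k}"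
    then obtain i where i: "i < k" "v = \<bar>?r i k - ?r i (Suc N)\<bar>" by auto
    show "v \<le> a k - \<eta>" using near[OF i(1)] m[OF i(1)] i(2) by linarith
  qed (use ne in auto)
  have u: "a k + \<eta> \<le> ?u"
  proof (rule Min.boundedI)
    fix v assume "v \<in> (\<lambda>i. ?r i k + ?r i (Suc N)) ` {..<k}"
    then obtain i where i: "i < k" "v = ?r i k + ?r i (Suc N)" by auto
    show "a k + \<eta> \<le> v" using near[OF i(1)] m[OF i(1)] i(2) by linarith
  qed (use ne in auto)
  have "?u \<le> ?r 0 k + ?r 0 (Suc N)" using ne by (intro Min_le) auto
  moreover have "\<bar>?r 0 k - ?r 0 (Suc N)\<bar> \<le> ?l" using ne by (intro Max_ge) auto
  ultimately have "?u - ?l \<le> 2 * a 0 + a k + 1"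
    using near[of 0] m[of 0] False \<eta> by linarith
  with l u \<eta> show ?thesis
    unfolding entry_kernel_triangle[OF kN(2)] Let_def entry_bound_def
    using False by (simp add: emeasure_uniform_interval_ge)
qed

lemma pred_hit: "Measurable.pred \<Omega> (hit n a \<eta> N)"
  unfolding hit_def
  by (rule pred_All_less) (unfold pred_def, intro borel_measurable_less borel_measurable_abs
      borel_measurable_diff borel_measurable_const measurable_Pi_real_component)

lemma hit_Suc: "hit (Suc k) a \<eta> N x \<longleftrightarrow> hit k a \<eta> N x \<and> \<bar>x (triangle N + k) - a k\<bar> < \<eta>"
  by (auto simp: hit_def less_Suc_eq)

lemma depends_below_hit: "depends_below (triangle N + k) (hit k a \<eta> N)"
  by (auto simp: depends_below_def hit_def)

lemma pred_margin: "Measurable.pred \<Omega> (\<lambda>x. margin n a \<eta> (matrix_of_seq x))"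
  unfolding margin_def
  by (intro pred_All_less pred_intros_imp' pred_intros_logic(3);
      unfold pred_def; intro borel_measurable_le borel_measurable_add borel_measurable_const
        measurable_matrix_of_seq)

lemma depends_below_margin: "n \<le> Suc N \<Longrightarrow> depends_below (triangle N) (\<lambda>x. margin n a \<eta> (matrix_of_seq x))"
  unfolding depends_below_def
proof (intro allI impI)
  fix x y :: "nat \<Rightarrow> real" assume n: "n \<le> Suc N" and eq: "\<forall>s<triangle N. x s = y s"
  have "matrix_of_seq x i j = matrix_of_seq y i j" if "i < n" "j < n" for i j
    using n that eq by (intro matrix_of_seq_cong[of N]) auto
  then show "margin n a \<eta> (matrix_of_seq x) = margin n a \<eta> (matrix_of_seq y)"
    by (simp add: margin_def)
qed

text \<open>Each further row costs one factor. The event \<open>A\<close> is decided by the earlier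
  columns, so the bound is uniform over the past.\<close>

lemma prob_hit_ge:
  assumes A: "Measurable.pred \<Omega> A" "depends_below (triangle N) A"
    "\<And>x. A x \<Longrightarrow> margin n a \<eta> (matrix_of_seq x)"
    and n: "k \<le> n" "n \<le> Suc N" and \<eta>: "\<eta> > 0" and a: "\<And>i. i < n \<Longrightarrow> 0 \<le> a i"
  shows "(\<Prod>i<k. entry_bound a \<eta> i) * L.prob {x. A x} \<le> L.prob {x. A x \<and> hit k a \<eta> N x}"
  using n(1)
proof (induction k)
  case 0
  then show ?case by (simp add: hit_def)
next
  case (Suc k)
  have k: "k < n" "k \<le> N" using Suc.prems n by auto
  have bound: "0 \<le> entry_bound a \<eta> k"
    using a[of 0] a[of k] k \<eta> by (simp add: entry_bound_def)
  have "entry_bound a \<eta> k * L.prob {x. A x \<and> hit k a \<eta> N x} \<le>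
      L.prob {x. (A x \<and> hit k a \<eta> N x) \<and> \<bar>x (triangle N + k) - a k\<bar> < \<eta>}"
  proof (rule prob_step_ge[where t="triangle N + k"])
    show "Measurable.pred \<Omega> (\<lambda>x. A x \<and> hit k a \<eta> N x)"
      by (rule pred_intros_logic(3)[OF A(1) pred_hit])
    show "depends_below (triangle N + k) (\<lambda>x. A x \<and> hit k a \<eta> N x)"
      by (intro depends_below_conj depends_below_hit depends_below_mono[OF A(2)]) simp
    show "Measurable.pred \<Omega> (\<lambda>x. \<bar>x (triangle N + k) - a k\<bar> < \<eta>)"
      by (unfold pred_def, intro borel_measurable_less borel_measurable_abs
        borel_measurable_diff borel_measurable_const measurable_Pi_real_component)
    show "depends_below (Suc (triangle N + k)) (\<lambda>x. \<bar>x (triangle N + k) - a k\<bar> < \<eta>)"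
      by (simp add: depends_below_def)
    show "ennreal (entry_bound a \<eta> k) \<le> emeasure (entry_kernel \<gamma> (triangle N + k) x)
        {y. \<bar>(x(triangle N + k := y)) (triangle N + k) - a k\<bar> < \<eta>}"
      if "A x \<and> hit k a \<eta> N x" for x
      using emeasure_entry_kernel_ge[OF k n(2) \<eta> A(3)] that by simp
  qed (rule bound)
  moreover have "(\<Prod>i<Suc k. entry_bound a \<eta> i) * L.prob {x. A x} \<le>
      entry_bound a \<eta> k * L.prob {x. A x \<and> hit k a \<eta> N x}"
    using mult_left_mono[OF Suc.IH bound] Suc.prems by (simp add: ac_simps)
  ultimately show ?case by (simp add: hit_Suc conj_assoc)
qed

text \<open>Whatever the earlier columns did, on the margin event the next one hits with conditional
  probability at least \<open>c\<close>, so the chance of \<open>M\<close> misses decays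
  geometrically. Starting with column \<open>Suc n\<close> puts the corner into the past.\<close>

lemma prob_no_hit_le:
  assumes n: "n > 0" and \<eta>: "\<eta> > 0" and a: "\<And>i. i < n \<Longrightarrow> 0 \<le> a i"
    and c: "0 \<le> c" "c \<le> 1" "c \<le> (\<Prod>i<n. entry_bound a \<eta> i)"
  shows "L.prob {x. margin n a \<eta> (matrix_of_seq x) \<and> (\<forall>N<M. \<not> hit n a \<eta> (n + N) x)} \<le> (1 - c) ^ M"
proof (induction M)
  case (Suc M)
  let ?A = "\<lambda>x. margin n a \<eta> (matrix_of_seq x) \<and> (\<forall>N<M. \<not> hit n a \<eta> (n + N) x)"
  have pred: "Measurable.pred \<Omega> ?A"
    by (intro pred_intros_logic(3) pred_margin pred_All_less pred_intros_logic(2) pred_hit)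
  have dep: "depends_below (triangle (n + M)) ?A"
  proof (intro depends_below_conj depends_below_margin)
    show "depends_below (triangle (n + M)) (\<lambda>x. \<forall>N<M. \<not> hit n a \<eta> (n + N) x)"
      unfolding depends_below_def
    proof (intro allI impI)
      fix x y :: "nat \<Rightarrow> real" assume eq: "\<forall>s<triangle (n + M). x s = y s"
      have "hit n a \<eta> (n + N) x = hit n a \<eta> (n + N) y" if "N < M" for N
        using depends_belowD[OF depends_below_hit[of "n + N" n a \<eta>], of x y] eq
          triangle_add_less[of n "n + N" "n + M"] that by auto
      then show "(\<forall>N<M. \<not> hit n a \<eta> (n + N) x) = (\<forall>N<M. \<not> hit n a \<eta> (n + N) y)" by simp
    qed
  qed simp
  have "c * L.prob {x. ?A x} \<le> (\<Prod>i<n. entry_bound a \<eta> i) * L.prob {x. ?A x}"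
    using c by (intro mult_right_mono) auto
  also have "\<dots> \<le> L.prob {x. ?A x \<and> hit n a \<eta> (n + M) x}"
    by (rule prob_hit_ge[OF pred dep]) (use \<eta> a in auto)
  finally have "L.prob {x. ?A x} - L.prob {x. ?A x \<and> hit n a \<eta> (n + M) x} \<le> (1 - c) * L.prob {x. ?A x}"
    by (simp add: algebra_simps)
  moreover have "L.prob ({x. ?A x} - {x. ?A x \<and> hit n a \<eta> (n + M) x}) =
      L.prob {x. ?A x} - L.prob {x. ?A x \<and> hit n a \<eta> (n + M) x}"
    by (rule L.finite_measure_Diff)
       (auto simp only: sets_L intro!: sets_Collect_pred(1) pred pred_intros_logic(3)[OF pred pred_hit])
  moreover have "{x. ?A x} - {x. ?A x \<and> hit n a \<eta> (n + M) x} =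
      {x. margin n a \<eta> (matrix_of_seq x) \<and> (\<forall>N<Suc M. \<not> hit n a \<eta> (n + N) x)}"
    by (auto simp: less_Suc_eq)
  moreover have "(1 - c) * L.prob {x. ?A x} \<le> (1 - c) * (1 - c) ^ M"
    using Suc.IH c by (intro mult_left_mono) auto
  ultimately show ?case by simp
qed simp

text \<open>Full support makes the factor of row \<open>0\<close> positive, and the other factors
  are positive by their form; hence the geometric bound tends to zero.\<close>

lemma AE_hit:
  assumes n: "n > 0" and \<eta>: "\<eta> > 0" and a: "\<And>i. i < n \<Longrightarrow> 0 \<le> a i" and supp: "{0..} \<subseteq> measure_support \<gamma>"
  shows "AE x in L. margin n a \<eta> (matrix_of_seq x) \<longrightarrow> (\<exists>N. hit n a \<eta> (n + N) x)"
proof -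
  interpret \<gamma>: prob_space \<gamma> by (rule prob_space_\<gamma>)
  have "entry_bound a \<eta> i > 0" if "i < n" for i
  proof (cases "i = 0")
    case True
    have "open {y. \<bar>y - a 0\<bar> < \<eta>}" by (intro open_Collect_less continuous_intros)
    moreover have "a 0 \<in> measure_support \<gamma>" using supp a[OF n] by auto
    ultimately have "emeasure \<gamma> {y. \<bar>y - a 0\<bar> < \<eta>} > 0"
      using \<eta> by (auto simp: measure_support_def)
    then show ?thesis using True by (simp add: entry_bound_def \<gamma>.emeasure_eq_measure)
  next
    case False
    then show ?thesis using a[OF n] a[OF that] \<eta> by (simp add: entry_bound_def)
  qed
  then have "(\<Prod>i<n. entry_bound a \<eta> i) > 0" by (intro prod_pos) auto
  \<comment> \<open>The product may exceed \<open>1\<close>, hence the cap, which keeps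
    \<open>1 - c\<close> in \<open>[0, 1)\<close>.\<close>
  then obtain c where c: "0 < c" "c \<le> 1" "c \<le> (\<Prod>i<n. entry_bound a \<eta> i)"
    by (intro that[of "min 1 (\<Prod>i<n. entry_bound a \<eta> i)"]) auto
  let ?Z = "{x. margin n a \<eta> (matrix_of_seq x) \<and> (\<forall>N. \<not> hit n a \<eta> (n + N) x)}"
  have Z: "?Z \<in> sets \<Omega>"
    by (intro sets_Collect_pred(1) pred_intros_logic(3) pred_margin pred_intros_countable(1)
        pred_intros_logic(2) pred_hit)
  have "L.prob ?Z \<le> (1 - c) ^ M" for M
  proof -
    have "L.prob ?Z \<le> L.prob {x. margin n a \<eta> (matrix_of_seq x) \<and> (\<forall>N<M. \<not> hit n a \<eta> (n + N) x)}"
    proof (rule L.finite_measure_mono)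
      have "Measurable.pred \<Omega> (\<lambda>x. margin n a \<eta> (matrix_of_seq x) \<and> (\<forall>N<M. \<not> hit n a \<eta> (n + N) x))"
        by (intro pred_intros_logic(3) pred_margin pred_All_less pred_intros_logic(2) pred_hit)
      then show "{x. margin n a \<eta> (matrix_of_seq x) \<and> (\<forall>N<M. \<not> hit n a \<eta> (n + N) x)} \<in> sets L"
        unfolding sets_L by (rule sets_Collect_pred(1))
    qed auto
    also have "\<dots> \<le> (1 - c) ^ M"
      using c by (intro prob_no_hit_le[OF n \<eta> a]) auto
    finally show ?thesis .
  qed
  moreover have "(\<lambda>M. (1 - c) ^ M) \<longlonglongrightarrow> 0" using c by (intro LIMSEQ_power_zero) auto
  ultimately have "L.prob ?Z \<le> 0"
    by (intro LIMSEQ_le_const[where X="\<lambda>M. (1 - c) ^ M"]) auto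
  then have "emeasure L ?Z = 0" by (simp add: L.emeasure_eq_measure measure_le_0_iff)
  then show ?thesis
    using Z by (intro AE_I[where N="?Z"]) (auto simp only: sets_L)
qed

lemma AE_rationally_universal:
  assumes "\<And>x. emeasure \<gamma> {x} = 0" "measure_support \<gamma> = {0..}"
  shows "AE x in L. rationally_universal (matrix_of_seq x)"
proof -
  have "AE x in L. \<forall>(q :: rat list) m. q \<noteq> [] \<longrightarrow> (\<forall>i<length q. q ! i \<ge> 0) \<longrightarrow>
      margin (length q) (\<lambda>i. real_of_rat (q ! i)) (inverse (real (Suc m))) (matrix_of_seq x) \<longrightarrow>
      (\<exists>N. hit (length q) (\<lambda>i. real_of_rat (q ! i)) (inverse (real (Suc m))) (length q + N) x)"
    unfolding AE_all_countable
  proof (intro allI)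
    fix q :: "rat list" and m
    show "AE x in L. q \<noteq> [] \<longrightarrow> (\<forall>i<length q. q ! i \<ge> 0) \<longrightarrow>
      margin (length q) (\<lambda>i. real_of_rat (q ! i)) (inverse (real (Suc m))) (matrix_of_seq x) \<longrightarrow>
      (\<exists>N. hit (length q) (\<lambda>i. real_of_rat (q ! i)) (inverse (real (Suc m))) (length q + N) x)"
    proof (cases "q \<noteq> [] \<and> (\<forall>i<length q. q ! i \<ge> 0)")
      case True
      then show ?thesis
        using AE_hit[of "length q" "inverse (real (Suc m))" "\<lambda>i. real_of_rat (q ! i)"] assms(2)
        by (simp del: of_nat_Suc)
    next
      case False
      then show ?thesis by (intro AE_I2) blast
    qed
  qed
  moreover have "AE x in L. matrix_of_seq x \<in> distance_matrices \<and> (\<forall>i j. i \<noteq> j \<longrightarrow> matrix_of_seq x i j > 0)"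
    using assms by (intro AE_distance_matrix) auto
  ultimately show ?thesis
  proof eventually_elim
    case (elim x)
    show ?case
      unfolding rationally_universal_def
    proof (intro conjI allI impI)
      fix q :: "rat list" and m
      assume q: "\<forall>i<length q. q ! i \<ge> 0"
        "margin (length q) (\<lambda>i. real_of_rat (q ! i)) (inverse (real (Suc m))) (matrix_of_seq x)"
      show "\<exists>l. \<forall>i<length q. \<bar>matrix_of_seq x i l - real_of_rat (q ! i)\<bar> < inverse (real (Suc m))"
      \<comment> \<open>For the empty list any column will do. Otherwise a hit with index
        \<open>length q + N\<close> concerns the column with the successor number.\<close>
      proof (cases "q = []")
        case False
        then obtain N where "hit (length q) (\<lambda>i. real_of_rat (q ! i)) (inverse (real (Suc m))) (length q + N) x"
          using elim(1) q by blast
        then show ?thesis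
          by (intro exI[of _ "Suc (length q + N)"]) (simp add: hit_def matrix_of_seq_Suc del: of_nat_Suc)
      qed simp
    qed (use elim in auto)
  qed
qed

lemma AE_random_matrix_measure:
  assumes "\<And>x. emeasure \<gamma> {x} = 0" "measure_support \<gamma> = {0..}"
  shows "AE r in random_matrix_measure \<gamma>. rationally_universal r"
proof -
  have "matrix_of_seq \<in> borel_measurable \<Omega>"
    by (intro measurable_coordinatewise_then_product measurable_matrix_of_seq)
  then have "matrix_of_seq \<in> borel_measurable L"
    by (simp only: measurable_cong_sets[OF sets_L refl])
  moreover have "{r \<in> space borel. rationally_universal r} \<in> sets borel"
    using pred_rationally_universal unfolding pred_def .
  ultimately show ?thesis
    unfolding random_matrix_measure_def using AE_rationally_universal[OF assms]
    by (subst AE_distr_iff) auto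
qed

end

section \<open>From universal matrices to the Urysohn space\<close>

lemma rationally_universal_completion:
  assumes r: "rationally_universal r"
  shows "Metric_space UNIV r" "mcomplete_of (mcompletion (metric (UNIV, r)))"
    "separable_space (mtopology_of (mcompletion (metric (UNIV, r))))"
    "extension_property (mcompletion (metric (UNIV, r)))"
proof -
  have pos: "r i j > 0" if "i \<noteq> j" for i j
    using r that unfolding rationally_universal_def by simp
  have dm: "r i i = 0 \<and> r i j \<ge> 0 \<and> r i j = r j i \<and> r i j \<le> r i k + r k j" for i j k
  proof -
    have "r \<in> distance_matrices"
      using r unfolding rationally_universal_def by (rule conjunct1)
    then show ?thesis unfolding distance_matrices_def by blast
  qed
  show 1: "Metric_space UNIV r"
  proof
    fix i j k
    show "0 \<le> r i j" "r i j = r j i" "r i k \<le> r i j + r j k"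
      using dm[of i j i] dm[of i k j] by blast+
    show "r i j = 0 \<longleftrightarrow> i = j"
      using dm[of i i i] pos[of i j] by (cases "i = j") simp_all
  qed
  interpret Metric_space UNIV r by (rule 1)
  note c = is_completion_mcompletion[of "metric (UNIV, r)"]
  show "mcomplete_of (mcompletion (metric (UNIV, r)))" using c by (simp add: is_completion_def)
  show "separable_space (mtopology_of (mcompletion (metric (UNIV, r))))"
    using c by (rule separable_completion_of_countable) simp
  show "extension_property (mcompletion (metric (UNIV, r)))"
    using rationally_universal_imp_universal[OF r] 1 c
    by (rule completion_of_universal_extension_property)
qed

theorem theorem4:
  fixes \<gamma> :: "real measure"
  assumes "prob_space \<gamma>" and "sets \<gamma> = sets borel"
    and "\<And>x. emeasure \<gamma> {x} = 0"
    and "measure_support \<gamma> = {0..}"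
  shows "(AE r in random_matrix_measure \<gamma>. universal_matrix r) \<and>
    (\<exists>U :: (nat \<Rightarrow> real) metric. urysohn_space U \<and>
      (AE r in random_matrix_measure \<gamma>.
        Metric_space UNIV r \<and> isometric_spaces (mcompletion (metric (UNIV, r))) U))"
proof -
  interpret random_matrix \<gamma> using assms(1,2) by (rule random_matrix.intro)
  interpret N: prob_space "random_matrix_measure \<gamma>"
    using assms(1,2) by (rule prob_space_random_matrix_measure)
  have AE: "AE r in random_matrix_measure \<gamma>. rationally_universal r"
    using assms(3,4) by (rule AE_random_matrix_measure)
  \<comment> \<open>A property that is almost sure under a probability measure holds for some matrix
    \<open>s\<close>. The completion for this one sample serves as the Urysohn space, and the
    extension property makes almost every other completion isometric to it.\<close>
  have "\<exists>r. rationally_universal r"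
  proof (rule ccontr)
    assume "\<not> ?thesis"
    with AE have "AE r in random_matrix_measure \<gamma>. False" by simp
    then show False by simp
  qed
  then obtain s where s: "rationally_universal s" by blast
  let ?U = "mcompletion (metric (UNIV, s))"
  note U = rationally_universal_completion[OF s]
  have "AE r in random_matrix_measure \<gamma>. universal_matrix r"
    using AE by eventually_elim (rule rationally_universal_imp_universal)
  moreover have "urysohn_space ?U"
    by (rule urysohn_space_if_extension_property[OF U(2-4)])
  moreover have "AE r in random_matrix_measure \<gamma>.
      Metric_space UNIV r \<and> isometric_spaces (mcompletion (metric (UNIV, r))) ?U"
    using AE
  proof eventually_elim
    case (elim r)
    note R = rationally_universal_completion[OF elim]
    show ?case using R(1) isometric_spaces_if_extension_property[OF R(2-4) U(2-4)] by blast
  qed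
  ultimately show ?thesis by blast
qed

end
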